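(* Let $p$ be an odd prime, let $\Gamma$ be a Fuchsian group of signature $(0;p,p,p,p)$ with its canonical tiling $\Delta(\alpha,\beta,\gamma)$, and let $\Gamma^*$ be a normal subgroup of $\Gamma$ with $\Gamma/\Gamma^*\simeq\mathbb{Z}/p\mathbb{Z}$, acting freely on $\Delta$, so that $\Delta/\Gamma^*\in\gimel_p$. Suppose that $\Gamma^*$ identifies the edges of the fundamental polygon $P(\alpha,\beta,\gamma)$ by $b_1\leftrightarrow b_{2i+2}$ and $c_1\leftrightarrow c_{2j+2}$. Then $\Gamma^*$ is generated by $$\{\,x^{ni}\,T_{b_1\leftrightarrow b_{2i+2}}\,x^{-ni},\ x^{nj}\,T_{c_1\leftrightarrow c_{2j+2}}\,x^{-nj}\,\}_{n=0}^{p-1},$$ where $T_{b_1\leftrightarrow b_{2i+2}}=x^iy^{-1}$ and $T_{c_1\leftrightarrow c_{2j+2}}=x^jz^{-1}$.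
   Context: $\Delta=\{z\in\mathbb{C}:|z|<1\}$ is the hyperbolic disk. $\gimel_p$ is the set of compact Riemann surfaces having an automorphism of order $p$ with exactly four fixed points and quotient isomorphic to $\mathbb{P}^1$. Tilings. For $\alpha,\beta,\gamma>0$ with $\alpha+\beta+\gamma=2\pi/p$, $\Delta(\alpha,\beta,\gamma)$ denotes the tiling of $\Delta$ by copies of a hyperbolic triangle with interior angles $\alpha,\beta,\gamma$ in counterclockwise order, obtained by repeatedly applying half-turns about midpoints of edges; $\Delta(\alpha,\beta,\gamma)=\Delta(\beta,\gamma,\alpha)=\Delta(\gamma,\alpha,\beta)$. It is a tiling for $\Gamma$ if $\Gamma$ is generated by the rotations through $2\pi/p$ about the three vertices of a tile. The canonical tiling of $\Gamma$ is the tiling for $\Gamma$ with $0<\alpha\le\pi/p$, $0<\beta,\gamma<\pi/p$ (written $\Delta(\pi/p,\beta,\gamma)$ with $\beta\ge\gamma$ if an angle equals $\pi/p$). The polygon. Let $A',B',C'$ be the vertices, in counterclockwise order, of a tile of the canonical tiling with angles $\alpha,\beta,\gamma$ at $A',B',C'$, and let $x,y,z$ be the counterclockwise rotations through $2\pi/p$ about $A',B',C'$; then $\Gamma=\langle x,y,z: x^p=y^p=z^p=(xyz)^p=1\rangle$ (products are composed right to left). Let $D',D'',D'''$ be the images of $C',A',B'$ under the half-turns about the midpoints of $A'B'$, $B'C'$, $C'A'$ respectively. $H_0$ is the hexagon with vertices $A',D',B',D'',C',D'''$ in this (counterclockwise) order; it is a fundamental domain for $\Gamma$. Put $H_k=x^k(H_0)$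 for $k=0,\dots,p-1$, and $P(\alpha,\beta,\gamma)=H_0\cup\dots\cup H_{p-1}$, a fundamental domain for $\Gamma^*$. Put $b_1=\overline{D'B'}$, $b_2=\overline{B'D''}$, $c_1=\overline{D''C'}$, $c_2=\overline{C'D'''}$, and let $b_{2k+1},b_{2k+2},c_{2k+1},c_{2k+2}$ be the images of $b_1,b_2,c_1,c_2$ under $x^k$. For edges $w,w'$ of $P(\alpha,\beta,\gamma)$, $w\leftrightarrow w'$ means that $w$ and $w'$ are glued in $\Delta/\Gamma^*$, and $T_{w\leftrightarrow w'}\in\Gamma^*$ is the element making this identification. Here $i,j\in\{1,\dots,p-1\}$ and $p\nmid i+j+1$. *)

theory Defs
  imports
    "HOL-Complex_Analysis.Riemann_Mapping"
    "HOL-Algebra.Group_Action"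
    "HOL-Algebra.Generated_Groups"
    "HOL-Algebra.Elementary_Groups"
begin

section \<open>The hyperbolic disk\<close>

abbreviation disk :: "complex set" where
  "disk \<equiv> ball 0 1"

text \<open>
  The orientation-preserving isometries of the Poincare disk are its biholomorphic self-maps.
  As in \<^const>\<open>BijGroup\<close>, functions are extensional (\<^const>\<open>undefined\<close> off the disk), and the
  product is composition from right to left.
\<close>

definition disk_aut :: "(complex \<Rightarrow> complex) monoid" where
  "disk_aut = (BijGroup disk)\<lparr>carrier := {f \<in> Bij disk. f holomorphic_on disk}\<rparr>"

abbreviation subgrp :: "(complex \<Rightarrow> complex) set \<Rightarrow> (complex \<Rightarrow> complex) monoid" where
  "subgrp G \<equiv> disk_aut\<lparr>carrier := G\<rparr>"

text \<open>\<open>Moebius_function 0 a\<close> is \<open>z \<mapsto> (z - a) / (1 - cnj a * z)\<close>, which moves \<open>a\<close> to the centre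
  of the disk; its inverse is \<open>Moebius_function 0 (- a)\<close>.\<close>

definition hdist :: "complex \<Rightarrow> complex \<Rightarrow> real" where
  "hdist a b = 2 * artanh (cmod (Moebius_function 0 a b))"

text \<open>Geodesics through the centre are Euclidean diameters.\<close>

definition hsegment :: "complex \<Rightarrow> complex \<Rightarrow> complex set" where
  "hsegment a b = Moebius_function 0 (- a) ` closed_segment 0 (Moebius_function 0 a b)"

definition hmidpoint :: "complex \<Rightarrow> complex \<Rightarrow> complex" where
  "hmidpoint a b = (THE m. m \<in> hsegment a b \<and> hdist a m = hdist m b)"

text \<open>Counterclockwise rotation about \<open>a\<close> through the angle \<open>t\<close>
  (\<open>Moebius_function t a\<close> is \<open>cis t\<close> times \<open>Moebius_function 0 a\<close>).\<close>

definition rotation :: "complex \<Rightarrow> real \<Rightarrow> complex \<Rightarrow> complex" where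
  "rotation a t = (\<lambda>z\<in>disk. Moebius_function 0 (- a) (Moebius_function t a z))"

text \<open>Half-turn about the midpoint of the geodesic segment joining \<open>a\<close> and \<open>b\<close>.\<close>

definition half_turn :: "complex \<Rightarrow> complex \<Rightarrow> complex \<Rightarrow> complex" where
  "half_turn a b = rotation (hmidpoint a b) pi"

text \<open>Oriented angle at \<open>a\<close> from the ray \<open>ab\<close> counterclockwise to the ray \<open>ac\<close>, in \<open>(-\<pi>, \<pi>]\<close>.\<close>

definition oangle :: "complex \<Rightarrow> complex \<Rightarrow> complex \<Rightarrow> real" where
  "oangle a b c = Arg (Moebius_function 0 a c / Moebius_function 0 a b)"

text \<open>A nondegenerate hyperbolic triangle with vertices \<open>a, b, c\<close> in counterclockwise order and
  interior angles \<open>\<alpha>, \<beta>, \<gamma>\<close> at them: positivity of the oriented angles encodes the orientation.\<close>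

definition ccw_triangle ::
  "complex \<Rightarrow> complex \<Rightarrow> complex \<Rightarrow> real \<Rightarrow> real \<Rightarrow> real \<Rightarrow> bool" where
  "ccw_triangle a b c \<alpha> \<beta> \<gamma> \<longleftrightarrow>
     a \<in> disk \<and> b \<in> disk \<and> c \<in> disk \<and>
     oangle a b c = \<alpha> \<and> oangle b c a = \<beta> \<and> oangle c a b = \<gamma> \<and>
     \<alpha> \<in> {0<..<pi} \<and> \<beta> \<in> {0<..<pi} \<and> \<gamma> \<in> {0<..<pi}"


section \<open>Fuchsian groups\<close>

text \<open>For subgroups of \<^const>\<open>disk_aut\<close>, discreteness is the same as acting properly
  discontinuously on the disk.\<close>

definition fuchsian_group :: "(complex \<Rightarrow> complex) set \<Rightarrow> bool" where
  "fuchsian_group G \<longleftrightarrow> subgroup G disk_aut \<and>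
     (\<forall>K. compact K \<and> K \<subseteq> disk \<longrightarrow> finite {g \<in> G. g ` K \<inter> K \<noteq> {}})"

abbreviation stab :: "(complex \<Rightarrow> complex) set \<Rightarrow> complex \<Rightarrow> (complex \<Rightarrow> complex) set" where
  "stab G z \<equiv> stabilizer (subgrp G) (\<lambda>g. g) z"

abbreviation orb :: "(complex \<Rightarrow> complex) set \<Rightarrow> complex \<Rightarrow> complex set" where
  "orb G z \<equiv> orbit (subgrp G) (\<lambda>g. g) z"

text \<open>
  Signature \<open>(0; m\<^sub>1, \<dots>, m\<^sub>r)\<close>: the orbit space, with the quotient topology, is a
  topological sphere, and there are exactly \<open>r\<close> orbits with nontrivial stabilizers, these being
  of orders \<open>m\<^sub>1, \<dots>, m\<^sub>r\<close>.
\<close>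

definition has_signature_genus0 :: "(complex \<Rightarrow> complex) set \<Rightarrow> nat list \<Rightarrow> bool" where
  "has_signature_genus0 G ms \<longleftrightarrow>
     (\<exists>q. quotient_map (top_of_set disk) (top_of_set (sphere (0 :: real ^ 3) 1)) q \<and>
        (\<forall>z\<in>disk. \<forall>w\<in>disk. q z = q w \<longleftrightarrow> orb G z = orb G w)) \<and>
     (\<exists>vs. length vs = length ms \<and> set vs \<subseteq> disk \<and> distinct (map (orb G) vs) \<and>
        (\<forall>k<length ms. 2 \<le> ms ! k \<and> card (stab G (vs ! k)) = ms ! k) \<and>
        (\<forall>z\<in>disk. stab G z \<noteq> {\<one>\<^bsub>disk_aut\<^esub>} \<longrightarrow> orb G z \<in> orb G ` set vs))"

definition acts_freely :: "(complex \<Rightarrow> complex) set \<Rightarrow> bool" where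
  "acts_freely G \<longleftrightarrow> (\<forall>z\<in>disk. stab G z = {\<one>\<^bsub>disk_aut\<^esub>})"


section \<open>Tilings\<close>

text \<open>
  A triangular tile is represented by the set of its three vertices, which determines it, and
  a tiling by its set of tiles.
\<close>

inductive_set tiles_from :: "complex set \<Rightarrow> complex set set" for t\<^sub>0 where
  base: "t\<^sub>0 \<in> tiles_from t\<^sub>0"
| step: "t \<in> tiles_from t\<^sub>0 \<Longrightarrow> a \<in> t \<Longrightarrow> b \<in> t \<Longrightarrow> a \<noteq> b \<Longrightarrow> half_turn a b ` t \<in> tiles_from t\<^sub>0"

text \<open>
  \<open>\<T>\<close> is a tiling \<open>\<Delta>(\<alpha>,\<beta>,\<gamma>)\<close>. That the triangles do tile the disk need not be required: it
  follows from \<open>\<alpha> + \<beta> + \<gamma> = 2\<pi>/p\<close>, as the angles around each vertex are \<open>\<alpha>, \<beta>, \<gamma>\<close>, each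
  occurring \<open>p\<close> times.
\<close>

definition is_tiling ::
  "nat \<Rightarrow> real \<Rightarrow> real \<Rightarrow> real \<Rightarrow> complex set set \<Rightarrow> bool" where
  "is_tiling p \<alpha> \<beta> \<gamma> \<T> \<longleftrightarrow> \<alpha> + \<beta> + \<gamma> = 2 * pi / real p \<and>
     (\<exists>a b c. ccw_triangle a b c \<alpha> \<beta> \<gamma> \<and> \<T> = tiles_from {a, b, c})"

definition tiling_for :: "nat \<Rightarrow> (complex \<Rightarrow> complex) set \<Rightarrow> complex set set \<Rightarrow> bool" where
  "tiling_for p G \<T> \<longleftrightarrow>
     (\<exists>t\<in>\<T>. G = generate disk_aut ((\<lambda>v. rotation v (2 * pi / real p)) ` t))"

definition canonical_tiling ::
  "nat \<Rightarrow> (complex \<Rightarrow> complex) set \<Rightarrow> real \<Rightarrow> real \<Rightarrow> real \<Rightarrow> complex set set \<Rightarrow> bool" where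
  "canonical_tiling p G \<alpha> \<beta> \<gamma> \<T> \<longleftrightarrow>
     is_tiling p \<alpha> \<beta> \<gamma> \<T> \<and> tiling_for p G \<T> \<and>
     0 < \<alpha> \<and> \<alpha> \<le> pi / real p \<and>
     0 < \<beta> \<and> \<beta> < pi / real p \<and>
     0 < \<gamma> \<and> \<gamma> < pi / real p \<and>
     (\<alpha> = pi / real p \<longrightarrow> \<gamma> \<le> \<beta>)"


section \<open>The polygon and its edge identifications\<close>

text \<open>
  In the hexagon \<open>H\<^sub>0\<close> with vertices \<open>A, D', B, D'', C, D'''\<close>, the vertices \<open>D', D'', D'''\<close> are
  \<open>half_turn A B C\<close>, \<open>half_turn B C A\<close>, \<open>half_turn C A B\<close>. The boundary of
  \<open>P(\<alpha>,\<beta>,\<gamma>) = H\<^sub>0 \<union> \<dots> \<union> H\<^bsub>p-1\<^esub>\<close> consists of the edges \<open>b\<^sub>n\<close> and \<open>c\<^sub>n\<close>, \<open>1 \<le> n \<le> 2p\<close>.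
  With \<open>k = (n - 1) div 2\<close>, one has \<open>n = 2k + 1\<close> for odd \<open>n\<close> and \<open>n = 2k + 2\<close> for even \<open>n\<close>.
\<close>

definition edge_b :: "nat \<Rightarrow> complex \<Rightarrow> complex \<Rightarrow> complex \<Rightarrow> nat \<Rightarrow> complex set" where
  "edge_b p A B C n =
     (rotation A (2 * pi / real p) [^]\<^bsub>disk_aut\<^esub> ((n - 1) div 2)) `
       (if odd n then hsegment (half_turn A B C) B else hsegment B (half_turn B C A))"

definition edge_c :: "nat \<Rightarrow> complex \<Rightarrow> complex \<Rightarrow> complex \<Rightarrow> nat \<Rightarrow> complex set" where
  "edge_c p A B C n =
     (rotation A (2 * pi / real p) [^]\<^bsub>disk_aut\<^esub> ((n - 1) div 2)) `
       (if odd n then hsegment (half_turn B C A) C else hsegment C (half_turn C A B))"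

definition glued :: "(complex \<Rightarrow> complex) set \<Rightarrow> complex set \<Rightarrow> complex set \<Rightarrow> bool" where
  "glued G w w' \<longleftrightarrow> (\<exists>T\<in>G. T ` w = w')"

definition gluing :: "(complex \<Rightarrow> complex) set \<Rightarrow> complex set \<Rightarrow> complex set \<Rightarrow> complex \<Rightarrow> complex" where
  "gluing G w w' = (THE T. T \<in> G \<and> T ` w = w')"

end

theory Submission
  imports Defs "HOL-Number_Theory.Cong" "HOL-Algebra.Multiplicative_Group"
begin

text \<open>
  With \<open>h\<^sub>1, h\<^sub>2, h\<^sub>3\<close> the half-turns about the midpoints of \<open>AB, BC, CA\<close>, the angle sum \<open>2\<pi>/p\<close> gives
  \<open>x = h\<^sub>3h\<^sub>2h\<^sub>1\<close>, \<open>y = h\<^sub>1h\<^sub>3h\<^sub>2\<close>, \<open>z = h\<^sub>2h\<^sub>1h\<^sub>3\<close>. Hence \<open>xyz\<close> is the inverse of the rotation about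
  \<open>h\<^sub>3(B)\<close>, so all tiles yield the same group and \<open>\<Gamma> = \<langle>x, y, z\<rangle>\<close>; moreover \<open>y(D'') = D'\<close> and
  \<open>z(D''') = D''\<close>. An element of \<open>\<Gamma>'\<close> carrying \<open>b\<^sub>1\<close> to \<open>b\<^bsub>2i+2\<^esub>\<close> that is not \<open>x\<^sup>iy\<^sup>-\<^sup>1\<close> would
  give an involution in \<open>\<Gamma>\<close> with a fixed point, which lies in \<open>\<Gamma>'\<close> because \<open>p\<close> is odd,
  contradicting freeness. Finally \<open>\<Gamma> = \<langle>x, T\<^sub>b, T\<^sub>c\<rangle>\<close> with \<open>x \<notin> \<Gamma>'\<close> of order \<open>p\<close>, so the
  conjugates of \<open>T\<^sub>b\<close> and \<open>T\<^sub>c\<close> by powers of \<open>x\<close> generate \<open>\<Gamma>'\<close>.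
\<close>

section \<open>Automorphisms of the disk\<close>

lemma carrier_disk_aut: "carrier disk_aut = {f \<in> Bij disk. f holomorphic_on disk}"
  by (simp add: disk_aut_def)

lemma disk_aut_mult:
  assumes "f \<in> carrier disk_aut" "g \<in> carrier disk_aut"
  shows "f \<otimes>\<^bsub>disk_aut\<^esub> g = compose disk f g"
  using assms by (simp add: disk_aut_def BijGroup_def)

lemma disk_aut_one: "\<one>\<^bsub>disk_aut\<^esub> = (\<lambda>z\<in>disk. z)"
  by (simp add: disk_aut_def BijGroup_def)

lemma disk_aut_one_apply: "z \<in> disk \<Longrightarrow> \<one>\<^bsub>disk_aut\<^esub> z = z"
  by (simp add: disk_aut_one)

text \<open>Closure under inverses is the point with content: an injective holomorphic map on an
  open set has a holomorphic inverse on its image.\<close>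

lemma subgroup_disk_aut: "subgroup {f \<in> Bij disk. f holomorphic_on disk} (BijGroup disk)"
proof (rule group.subgroupI[OF group_BijGroup])
  have "(\<lambda>z\<in>disk. z) \<in> {f \<in> Bij disk. f holomorphic_on disk}"
    using id_Bij[of disk] holomorphic_on_id by (auto intro: holomorphic_transform[where f="\<lambda>z. z"])
  then show "{f \<in> Bij disk. f holomorphic_on disk} \<noteq> {}" by blast
next
  fix f assume f: "f \<in> {f \<in> Bij disk. f holomorphic_on disk}"
  then have bij: "bij_betw f disk disk" and hol: "f holomorphic_on disk" by (auto simp: Bij_def)
  obtain g where g: "g holomorphic_on f ` disk" "\<And>z. z \<in> disk \<Longrightarrow> g (f z) = z"
    using holomorphic_has_inverse[OF hol open_ball] bij by (metis bij_betw_def)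
  have "g holomorphic_on disk" using g(1) bij by (simp add: bij_betw_def)
  moreover have "g w = (\<lambda>x\<in>disk. inv_into disk f x) w" if "w \<in> disk" for w
    using that g(2)[of "inv_into disk f w"] bij_betw_inv_into_right[OF bij that]
      bij_betw_apply[OF bij_betw_inv_into[OF bij] that] by simp
  ultimately have "(\<lambda>x\<in>disk. inv_into disk f x) holomorphic_on disk"
    by (rule holomorphic_transform)
  with f show "inv\<^bsub>BijGroup disk\<^esub> f \<in> {f \<in> Bij disk. f holomorphic_on disk}"
    by (simp add: inv_BijGroup restrict_inv_into_Bij)
next
  fix f g assume f: "f \<in> {f \<in> Bij disk. f holomorphic_on disk}"
    and g: "g \<in> {f \<in> Bij disk. f holomorphic_on disk}"
  have "g ` disk \<subseteq> disk" using g Bij_imp_funcset by fast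
  then have "f \<circ> g holomorphic_on disk" using f g by (auto intro: holomorphic_on_compose_gen)
  then have "compose disk f g holomorphic_on disk"
    by (rule holomorphic_transform) (simp add: compose_def)
  with f g show "f \<otimes>\<^bsub>BijGroup disk\<^esub> g \<in> {f \<in> Bij disk. f holomorphic_on disk}"
    by (simp add: BijGroup_def compose_Bij)
qed (auto simp: BijGroup_def)

lemma group_disk_aut: "group disk_aut"
  unfolding disk_aut_def by (rule subgroup.subgroup_is_group[OF subgroup_disk_aut group_BijGroup])

interpretation disk_aut: group disk_aut
  by (rule group_disk_aut)

lemma disk_aut_in_disk: "f \<in> carrier disk_aut \<Longrightarrow> z \<in> disk \<Longrightarrow> f z \<in> disk"
  unfolding carrier_disk_aut using Bij_imp_funcset by blast

lemma disk_aut_mult_apply: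
  assumes "f \<in> carrier disk_aut" "g \<in> carrier disk_aut" "z \<in> disk"
  shows "(f \<otimes>\<^bsub>disk_aut\<^esub> g) z = f (g z)"
  using assms by (simp add: disk_aut_mult compose_def)

lemma disk_aut_eqI:
  assumes "f \<in> carrier disk_aut" "g \<in> carrier disk_aut" "\<And>z. z \<in> disk \<Longrightarrow> f z = g z"
  shows "f = g"
  using assms unfolding carrier_disk_aut by (blast intro: extensionalityI Bij_imp_extensional)

lemma disk_aut_inv_apply:
  assumes "f \<in> carrier disk_aut" "z \<in> disk"
  shows "(inv\<^bsub>disk_aut\<^esub> f) (f z) = z" "f ((inv\<^bsub>disk_aut\<^esub> f) z) = z"
  using assms disk_aut_mult_apply[of "inv\<^bsub>disk_aut\<^esub> f" f z] disk_aut_mult_apply[of f "inv\<^bsub>disk_aut\<^esub> f" z]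
  by (simp_all add: disk_aut_one_apply)

lemma disk_aut_inj:
  assumes "f \<in> carrier disk_aut" "z \<in> disk" "w \<in> disk" "f z = f w"
  shows "z = w"
  using assms disk_aut_inv_apply(1) by metis

section \<open>Moebius maps and the rigidity of disk automorphisms\<close>

abbreviation moeb :: "complex \<Rightarrow> complex \<Rightarrow> complex" where
  "moeb \<equiv> Moebius_function 0"

lemma moeb_in_disk: "a \<in> disk \<Longrightarrow> z \<in> disk \<Longrightarrow> moeb a z \<in> disk"
  by (simp add: Moebius_function_norm_lt_1)

lemma moeb_inverse:
  assumes "a \<in> disk" "z \<in> disk"
  shows "moeb (- a) (moeb a z) = z" "moeb a (moeb (- a) z) = z"
  using assms by (auto intro!: Moebius_function_compose)

lemma moeb_inj: "a \<in> disk \<Longrightarrow> z \<in> disk \<Longrightarrow> w \<in> disk \<Longrightarrow> moeb a z = moeb a w \<Longrightarrow> z = w"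
  using moeb_inverse(1) by metis

lemma moeb_eq_0_iff: "a \<in> disk \<Longrightarrow> z \<in> disk \<Longrightarrow> moeb a z = 0 \<longleftrightarrow> z = a"
  using moeb_inj[of a z a] by (auto simp: Moebius_function_eq_zero)

lemma moeb_0_right: "moeb a 0 = - a"
  by (simp add: Moebius_function_of_zero)

lemma cmod_moeb_commute: "cmod (moeb a b) = cmod (moeb b a)"
proof -
  have "cmod (1 - cnj a * b) = cmod (cnj (1 - cnj a * b))" by (rule complex_mod_cnj[symmetric])
  also have "\<dots> = cmod (1 - cnj b * a)" by (simp add: mult.commute)
  finally show ?thesis by (simp add: Moebius_function_simple norm_divide norm_minus_commute)
qed

lemma cmod_moeb_less_1: "a \<in> disk \<Longrightarrow> b \<in> disk \<Longrightarrow> cmod (moeb a b) < 1"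
  by (simp add: Moebius_function_norm_lt_1)

lemma disk_aut_restrictI:
  assumes "f holomorphic_on disk" "\<And>z. z \<in> disk \<Longrightarrow> f z \<in> disk" "\<And>z. z \<in> disk \<Longrightarrow> g z \<in> disk"
    "\<And>z. z \<in> disk \<Longrightarrow> f (g z) = z" "\<And>z. z \<in> disk \<Longrightarrow> g (f z) = z"
  shows "restrict f disk \<in> carrier disk_aut"
proof -
  have "bij_betw f disk disk"
    by (rule bij_betw_byWitness[where f'=g]) (use assms in auto)
  then have "bij_betw (restrict f disk) disk disk"
    by (simp add: bij_betw_def inj_on_def)
  moreover have "restrict f disk holomorphic_on disk"
    by (rule holomorphic_transform[OF assms(1)]) simp
  ultimately show ?thesis by (simp add: carrier_disk_aut Bij_def)
qed

lemma moeb_disk_aut: "a \<in> disk \<Longrightarrow> restrict (moeb a) disk \<in> carrier disk_aut"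
  by (rule disk_aut_restrictI[where g="moeb (- a)"])
     (auto simp: Moebius_function_holomorphic Moebius_function_norm_lt_1 moeb_inverse)

text \<open>Moving \<open>a\<close> and \<open>g a\<close> to the centre turns \<open>g\<close> into
  an automorphism fixing 0, which is a rotation by the Schwarz lemma. So \<open>g\<close> acts on
  all the vectors \<open>moeb a b\<close>, which record the direction and distance of
  \<open>b\<close> seen from \<open>a\<close>, by one unit factor \<tau>. The later metric and angle
  computations rest on this.\<close>

lemma disk_aut_moeb:
  assumes g: "g \<in> carrier disk_aut" and a: "a \<in> disk"
  obtains \<tau> where "cmod \<tau> = 1" "\<And>b. b \<in> disk \<Longrightarrow> moeb (g a) (g b) = \<tau> * moeb a b"
proof -
  define f where "f = (\<lambda>z. moeb (g a) (g (moeb (- a) z)))"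
  define k where "k = (\<lambda>z. moeb a ((inv\<^bsub>disk_aut\<^esub> g) (moeb (- g a) z)))"
  have ma: "- a \<in> disk" and ga: "g a \<in> disk" and mga: "- g a \<in> disk"
    using a disk_aut_in_disk[OF g a] by auto
  have ig: "inv\<^bsub>disk_aut\<^esub> g \<in> carrier disk_aut" using g by simp
  note ind = moeb_in_disk disk_aut_in_disk[OF g] disk_aut_in_disk[OF ig]
  have hol: "h holomorphic_on disk" if "h \<in> carrier disk_aut" for h
    using that by (simp add: carrier_disk_aut)
  have holm: "moeb b holomorphic_on disk" if "b \<in> disk" for b
    using that by (simp add: Moebius_function_holomorphic)
  have fk: "moeb c \<circ> (h \<circ> moeb d) holomorphic_on disk"
    if c: "c \<in> disk" and h: "h \<in> carrier disk_aut" and d: "d \<in> disk" for c d h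
  proof -
    have "h \<circ> moeb d holomorphic_on disk"
      by (rule holomorphic_on_compose_gen[OF holm[OF d] hol[OF h]]) (use moeb_in_disk[OF d] in blast)
    moreover have "(h \<circ> moeb d) ` disk \<subseteq> disk"
      using disk_aut_in_disk[OF h] moeb_in_disk[OF d] by auto
    ultimately show ?thesis by (rule holomorphic_on_compose_gen[OF _ holm[OF c]])
  qed
  have fhol: "f holomorphic_on disk" and khol: "k holomorphic_on disk"
    using fk[OF ga g ma] fk[OF a ig mga] by (simp_all add: f_def k_def o_def)
  have fd: "f z \<in> disk" and kd: "k z \<in> disk" if "z \<in> disk" for z
    using that ind a ma ga mga by (auto simp: f_def k_def simp del: mem_ball_0 mem_ball)
  have f0: "f 0 = 0" using a by (simp add: f_def moeb_0_right Moebius_function_eq_zero)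
  have k0: "k 0 = 0" using a g
    by (simp add: k_def moeb_0_right Moebius_function_eq_zero disk_aut_inv_apply)
  have kf: "k (f z) = z" if "z \<in> disk" for z
    using that a ga ma ind(1)[of "- a" z]
    by (simp add: f_def k_def moeb_inverse disk_aut_inv_apply[OF g] ind del: mem_ball_0 mem_ball)
  have le1: "cmod (f z) \<le> cmod z" if "z \<in> disk" for z
    by (rule Schwarz_Lemma(1)[OF fhol f0]) (use fd that in auto)
  have le2: "cmod (k z) \<le> cmod z" if "z \<in> disk" for z
    by (rule Schwarz_Lemma(1)[OF khol k0]) (use kd that in auto)
  \<comment> \<open>The Schwarz inequalities for \<open>f\<close> and for its inverse
    \<open>k\<close> force equality at every point. One nonzero point, here 1/2, is enough to make
    \<open>f\<close> a rotation.\<close>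
  have "cmod (f (1/2)) = cmod (1/2)"
    using le1[of "1/2"] le2[of "f (1/2)"] fd[of "1/2"] kf[of "1/2"] by (simp add: norm_divide)
  then have "\<exists>z. cmod z < 1 \<and> z \<noteq> 0 \<and> cmod (f z) = cmod z"
    by (intro exI[of _ "1/2"]) (simp add: norm_divide)
  then obtain \<tau> where \<tau>: "\<And>z. cmod z < 1 \<Longrightarrow> f z = \<tau> * z" "cmod \<tau> = 1"
    using Schwarz_Lemma(3)[OF fhol f0, of 0] fd by auto
  show ?thesis
  proof (rule that[OF \<tau>(2)])
    fix b assume b: "b \<in> disk"
    have "f (moeb a b) = moeb (g a) (g b)" using a b by (simp add: f_def moeb_inverse)
    then show "moeb (g a) (g b) = \<tau> * moeb a b"
      using \<tau>(1)[of "moeb a b"] a b by (simp add: Moebius_function_norm_lt_1)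
  qed
qed

lemma cmod_moeb_disk_aut:
  assumes "g \<in> carrier disk_aut" "a \<in> disk" "b \<in> disk"
  shows "cmod (moeb (g a) (g b)) = cmod (moeb a b)"
  using disk_aut_moeb[OF assms(1,2)] assms(3) by (metis mult_1 norm_mult)

text \<open>Given the image of \<open>a\<close>, an automorphism is determined by its factor in
  \<open>disk_aut_moeb\<close>, and the image of \<open>b\<close> fixes that factor because
  \<open>moeb a b\<close> is nonzero. This identifies half-turns, their products and gluing elements
  from their values at two points.\<close>

lemma disk_aut_eq_two_points:
  assumes g: "g \<in> carrier disk_aut" and h: "h \<in> carrier disk_aut"
    and ab: "a \<in> disk" "b \<in> disk" "a \<noteq> b" and eq: "g a = h a" "g b = h b"
  shows "g = h"
proof (rule disk_aut_eqI[OF g h])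
  fix z assume z: "z \<in> disk"
  obtain \<sigma> where \<sigma>: "\<And>b. b \<in> disk \<Longrightarrow> moeb (g a) (g b) = \<sigma> * moeb a b"
    using disk_aut_moeb[OF g ab(1)] by metis
  obtain \<tau> where \<tau>: "\<And>b. b \<in> disk \<Longrightarrow> moeb (h a) (h b) = \<tau> * moeb a b"
    using disk_aut_moeb[OF h ab(1)] by metis
  have "\<sigma> * moeb a b = \<tau> * moeb a b" using \<sigma>[OF ab(2)] \<tau>[OF ab(2)] eq by metis
  moreover have "moeb a b \<noteq> 0" using ab by (simp add: moeb_eq_0_iff)
  ultimately have "\<sigma> = \<tau>" by simp
  then have "moeb (h a) (g z) = moeb (h a) (h z)" using \<sigma>[OF z] \<tau>[OF z] eq(1) by simp
  then show "g z = h z"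
    by (intro moeb_inj[OF disk_aut_in_disk[OF h ab(1)] disk_aut_in_disk[OF g z] disk_aut_in_disk[OF h z]])
qed

section \<open>Rotations of the disk\<close>

lemma rotation_apply: "z \<in> disk \<Longrightarrow> rotation a t z = moeb (- a) (cis t * moeb a z)"
  by (simp add: rotation_def Moebius_function_def cis_conv_exp)

lemma moeb_rotation:
  assumes "a \<in> disk" "z \<in> disk"
  shows "moeb a (rotation a t z) = cis t * moeb a z"
proof -
  have "cis t * moeb a z \<in> disk"
    using cmod_moeb_less_1[OF assms] by (simp add: norm_mult)
  then have "moeb a (moeb (- a) (cis t * moeb a z)) = cis t * moeb a z"
    by (rule moeb_inverse(2)[OF assms(1)])
  then show ?thesis by (simp only: rotation_apply[OF assms(2)])
qed

lemma rotation_in_disk: "a \<in> disk \<Longrightarrow> z \<in> disk \<Longrightarrow> rotation a t z \<in> disk"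
  by (simp add: rotation_def Moebius_function_norm_lt_1)

lemma rotation_add:
  assumes "a \<in> disk" "z \<in> disk"
  shows "rotation a s (rotation a t z) = rotation a (s + t) z"
  by (rule moeb_inj[of a])
     (use assms in \<open>simp_all add: rotation_in_disk moeb_rotation cis_mult[symmetric] del: mem_ball_0 mem_ball\<close>)

lemma rotation_cis_1:
  assumes "a \<in> disk" "z \<in> disk" "cis t = 1"
  shows "rotation a t z = z"
  by (rule moeb_inj[of a]) (use assms in \<open>simp_all add: rotation_in_disk moeb_rotation del: mem_ball_0 mem_ball\<close>)

lemma rotation_fixes: "a \<in> disk \<Longrightarrow> rotation a t a = a"
  by (simp add: rotation_apply Moebius_function_eq_zero moeb_0_right)

lemma rotation_disk_aut:
  assumes a: "a \<in> disk"
  shows "rotation a t \<in> carrier disk_aut"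
proof -
  have ma: "- a \<in> disk" using a by simp
  have "moeb (- a) \<circ> Moebius_function t a holomorphic_on disk"
  proof (rule holomorphic_on_compose_gen)
    show "Moebius_function t a holomorphic_on disk" "moeb (- a) holomorphic_on disk"
      using a ma by (simp_all add: Moebius_function_holomorphic)
    show "Moebius_function t a ` disk \<subseteq> disk"
      using a by (auto simp: Moebius_function_norm_lt_1)
  qed
  then have hol: "rotation a t holomorphic_on disk"
    by (rule holomorphic_transform) (simp add: rotation_def)
  have inverse: "rotation a s (rotation a (- s) z) = z" if z: "z \<in> disk" for s z
    using rotation_add[OF a z, of s "- s"] rotation_cis_1[OF a z, of 0] by simp
  have "restrict (rotation a t) disk \<in> carrier disk_aut"
    by (rule disk_aut_restrictI[OF hol, where g="rotation a (- t)"])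
       (use rotation_in_disk[OF a] inverse inverse[of _ "- t"] in simp_all)
  then show ?thesis by (simp add: rotation_def)
qed

text \<open>In the coordinates \<open>moeb a\<close> and \<open>moeb (g a)\<close> the map
  \<open>g\<close> is multiplication by a constant, which commutes with multiplication by
  \<open>cis t\<close>.\<close>

lemma rotation_conjugate:
  assumes g: "g \<in> carrier disk_aut" and a: "a \<in> disk" and z: "z \<in> disk"
  shows "rotation (g a) t (g z) = g (rotation a t z)"
proof -
  obtain \<tau> where \<tau>: "\<And>b. b \<in> disk \<Longrightarrow> moeb (g a) (g b) = \<tau> * moeb a b"
    using disk_aut_moeb[OF g a] by metis
  note ga = disk_aut_in_disk[OF g a] and gz = disk_aut_in_disk[OF g z] and rz = rotation_in_disk[OF a z]
  have "moeb (g a) (rotation (g a) t (g z)) = moeb (g a) (g (rotation a t z))"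
    unfolding moeb_rotation[OF ga gz] \<tau>[OF z] \<tau>[OF rz] moeb_rotation[OF a z] by simp
  then show ?thesis
    by (rule moeb_inj[OF ga rotation_in_disk[OF ga gz] disk_aut_in_disk[OF g rz]])
qed

lemma rotation_pow:
  assumes a: "a \<in> disk"
  shows "rotation a t [^]\<^bsub>disk_aut\<^esub> (n::nat) = rotation a (real n * t)"
proof (induction n)
  case 0
  show ?case
    by (rule disk_aut_eqI)
       (use a in \<open>auto simp: rotation_disk_aut rotation_cis_1 disk_aut_one_apply simp del: mem_ball_0 mem_ball\<close>)
next
  case (Suc n)
  show ?case
    by (rule disk_aut_eqI)
       (use a in \<open>auto simp: Suc rotation_disk_aut disk_aut_mult_apply rotation_add algebra_simps simp del: mem_ball_0 mem_ball\<close>)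
qed

section \<open>Segments and half-turns\<close>

lemma artanh_real_inj:
  assumes "-1 < x" "x < 1" "-1 < y" "y < (1::real)" "artanh x = artanh y"
  shows "x = y"
proof -
  have "ln ((1 + x) / (1 - x)) = ln ((1 + y) / (1 - y))"
    using assms(5) by (simp add: artanh_def)
  then have "(1 + x) / (1 - x) = (1 + y) / (1 - y)"
    using assms by (subst (asm) ln_inj_iff) auto
  then show ?thesis using assms by (simp add: field_simps)
qed

text \<open>Injectivity of \<open>artanh\<close> lets distances be compared through
  \<open>cmod (moeb a b)\<close>, which is algebraic along a segment.\<close>

lemma hdist_eq_iff:
  assumes "a \<in> disk" "b \<in> disk" "c \<in> disk" "d \<in> disk"
  shows "hdist a b = hdist c d \<longleftrightarrow> cmod (moeb a b) = cmod (moeb c d)"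
proof -
  have "- 1 < cmod w" for w by (rule order.strict_trans2[OF _ norm_ge_zero]) simp
  then show ?thesis
    using artanh_real_inj[of "cmod (moeb a b)" "cmod (moeb c d)"] cmod_moeb_less_1 assms
    by (auto simp: hdist_def simp del: mem_ball_0 mem_ball)
qed

text \<open>The parameter is the Euclidean fraction along the diameter once \<open>a\<close> sits at
  the centre. It is not proportional to hyperbolic length, so the midpoint does not have parameter
  1/2 when the ends are distinct.\<close>

definition hpoint :: "complex \<Rightarrow> complex \<Rightarrow> real \<Rightarrow> complex" where
  "hpoint a b t = moeb (- a) (of_real t * moeb a b)"

lemma hsegment_eq: "hsegment a b = hpoint a b ` {0..1}"
proof -
  have "closed_segment 0 (moeb a b) = (\<lambda>t. of_real t * moeb a b) ` {0..1}"
    by (auto simp: closed_segment_def scaleR_conv_of_real)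
  then show ?thesis by (simp add: hsegment_def hpoint_def image_image)
qed

lemma scaled_moeb_in_disk:
  assumes "a \<in> disk" "b \<in> disk" "t \<in> {0..1}"
  shows "of_real t * moeb a b \<in> disk"
proof -
  have "t * cmod (moeb a b) \<le> cmod (moeb a b)"
    using assms(3) by (simp add: mult_left_le_one_le)
  then show ?thesis using cmod_moeb_less_1[OF assms(1,2)] assms(3) by (simp add: norm_mult)
qed

lemma hpoint_in_disk: "a \<in> disk \<Longrightarrow> b \<in> disk \<Longrightarrow> t \<in> {0..1} \<Longrightarrow> hpoint a b t \<in> disk"
  unfolding hpoint_def by (rule moeb_in_disk[OF _ scaled_moeb_in_disk]) simp_all

lemma hpoint_0: "a \<in> disk \<Longrightarrow> hpoint a b 0 = a"
  by (simp add: hpoint_def moeb_0_right)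

lemma hpoint_1: "a \<in> disk \<Longrightarrow> b \<in> disk \<Longrightarrow> hpoint a b 1 = b"
  by (simp add: hpoint_def moeb_inverse)

lemma hsegment_subset_disk: "a \<in> disk \<Longrightarrow> b \<in> disk \<Longrightarrow> hsegment a b \<subseteq> disk"
  using hpoint_in_disk by (auto simp: hsegment_eq simp del: mem_ball_0 mem_ball)

lemma endpoints_in_hsegment:
  assumes "a \<in> disk" "b \<in> disk"
  shows "a \<in> hsegment a b" "b \<in> hsegment a b"
  unfolding hsegment_eq
  using image_eqI[of a "hpoint a b" 0 "{0..1}"] image_eqI[of b "hpoint a b" 1 "{0..1}"]
    hpoint_0[OF assms(1), of b] hpoint_1[OF assms] by simp_all

lemma hpoint_denominator_pos:
  assumes "a \<in> disk" "b \<in> disk" "s \<in> {0..1}" "t \<in> {0..1}"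
  shows "0 < 1 - s * t * (cmod (moeb a b))\<^sup>2"
proof -
  have "(cmod (moeb a b))\<^sup>2 < 1"
    using cmod_moeb_less_1[OF assms(1,2)] by (simp add: power_less_one_iff abs_square_less_1)
  moreover have "s * t * (cmod (moeb a b))\<^sup>2 \<le> 1 * (cmod (moeb a b))\<^sup>2"
    using assms(3,4) by (intro mult_right_mono) (auto intro: mult_le_one)
  ultimately show ?thesis by simp
qed

text \<open>The automorphism \<open>moeb (- a)\<close> contributes only a unit factor; between two
  points of a diameter, \<open>moeb\<close> is a real multiple of its direction. A single \<tau>
  serves all \<open>t\<close>, so the two ends can be compared as seen from the same point.\<close>

lemma moeb_hpoints:
  assumes a: "a \<in> disk" and b: "b \<in> disk" and s: "s \<in> {0..1}"
  obtains \<tau> where "cmod \<tau> = 1"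
    "\<And>t. t \<in> {0..1} \<Longrightarrow> moeb (hpoint a b s) (hpoint a b t) =
       \<tau> * (of_real ((t - s) / (1 - s * t * (cmod (moeb a b))\<^sup>2)) * moeb a b)"
proof -
  define q where "q = moeb a b"
  have ma: "- a \<in> disk" using a by simp
  have scaled: "of_real t * q \<in> disk" if "t \<in> {0..1}" for t
    unfolding q_def by (rule scaled_moeb_in_disk[OF a b that])
  obtain \<tau> where \<tau>: "cmod \<tau> = 1"
    "\<And>w. w \<in> disk \<Longrightarrow> moeb (restrict (moeb (- a)) disk (of_real s * q)) (restrict (moeb (- a)) disk w)
       = \<tau> * moeb (of_real s * q) w"
    using disk_aut_moeb[OF moeb_disk_aut[OF ma] scaled[OF s]] by metis
  show ?thesis
  proof (rule that[OF \<tau>(1)])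
    fix t :: real assume t: "t \<in> {0..1}"
    have "moeb (hpoint a b s) (hpoint a b t) = \<tau> * moeb (of_real s * q) (of_real t * q)"
      using \<tau>(2)[OF scaled[OF t]] scaled[OF s] scaled[OF t]
      by (simp add: hpoint_def q_def del: mem_ball_0 mem_ball)
    also have "moeb (of_real s * q) (of_real t * q) =
        of_real (t - s) * q / (1 - of_real (s * t) * (q * cnj q))"
      by (simp add: Moebius_function_simple algebra_simps)
    also have "\<dots> = of_real ((t - s) / (1 - s * t * (cmod q)\<^sup>2)) * q"
      by (simp add: complex_norm_square[symmetric])
    finally show "moeb (hpoint a b s) (hpoint a b t) =
       \<tau> * (of_real ((t - s) / (1 - s * t * (cmod (moeb a b))\<^sup>2)) * moeb a b)"
      by (simp add: q_def)
  qed
qed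

lemma cmod_moeb_hpoints:
  assumes "a \<in> disk" "b \<in> disk" "s \<in> {0..1}" "t \<in> {0..1}"
  shows "cmod (moeb (hpoint a b s) (hpoint a b t)) =
     \<bar>t - s\<bar> / (1 - s * t * (cmod (moeb a b))\<^sup>2) * cmod (moeb a b)"
proof -
  obtain \<tau> where "cmod \<tau> = 1" "moeb (hpoint a b s) (hpoint a b t) =
       \<tau> * (of_real ((t - s) / (1 - s * t * (cmod (moeb a b))\<^sup>2)) * moeb a b)"
    using moeb_hpoints[OF assms(1,2,3)] assms(4) by metis
  then show ?thesis
    using hpoint_denominator_pos[OF assms] by (simp only: norm_mult norm_of_real abs_divide)
qed

text \<open>The difference of the two sides is \<open>(1 - t) + s * (1 - t * R)\<close>, a sum of
  nonnegative terms that both vanish only at the two ends.\<close>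

lemma hsegment_diameter_aux:
  fixes s t R :: real
  assumes "s \<in> {0..1}" "t \<in> {0..1}" "0 \<le> R" "R < 1" "s \<le> t"
  shows "t - s \<le> 1 - s * t * R" "t - s = 1 - s * t * R \<Longrightarrow> s = 0 \<and> t = 1"
proof -
  have "t * R \<le> R"
    using assms by (simp add: mult_left_le_one_le)
  then have tR: "0 < 1 - t * R" using assms(4) by simp
  have eq: "1 - s * t * R - (t - s) = (1 - t) + s * (1 - t * R)"
    by (simp add: algebra_simps)
  have nonneg: "0 \<le> 1 - t" "0 \<le> s * (1 - t * R)" using assms tR by auto
  with eq show "t - s \<le> 1 - s * t * R" by linarith
  assume "t - s = 1 - s * t * R"
  with eq nonneg have "1 - t = 0" "s * (1 - t * R) = 0" by linarith+
  then show "s = 0 \<and> t = 1" using tR by simp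
qed

text \<open>A segment is determined by its end points because they are the only pair of its points
  at maximal distance.\<close>

lemma hsegment_diameter:
  assumes a: "a \<in> disk" and b: "b \<in> disk" and u: "u \<in> hsegment a b" and v: "v \<in> hsegment a b"
  shows "cmod (moeb u v) \<le> cmod (moeb a b)"
    and "cmod (moeb u v) = cmod (moeb a b) \<Longrightarrow> a \<noteq> b \<Longrightarrow> (u = a \<and> v = b) \<or> (u = b \<and> v = a)"
proof -
  obtain s t where s: "s \<in> {0..1}" "u = hpoint a b s" and t: "t \<in> {0..1}" "v = hpoint a b t"
    using u v by (auto simp: hsegment_eq)
  define R where "R = (cmod (moeb a b))\<^sup>2"
  have R: "0 \<le> R" "R < 1"
    using cmod_moeb_less_1[OF a b] by (simp_all add: R_def abs_square_less_1)
  have pos: "0 < 1 - s * t * R"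
    using hpoint_denominator_pos[OF a b s(1) t(1)] by (simp add: R_def)
  have eq: "cmod (moeb u v) = \<bar>t - s\<bar> / (1 - s * t * R) * cmod (moeb a b)"
    using cmod_moeb_hpoints[OF a b s(1) t(1)] by (simp add: s t R_def)
  have le: "\<bar>t - s\<bar> \<le> 1 - s * t * R"
    using hsegment_diameter_aux(1)[OF s(1) t(1) R] hsegment_diameter_aux(1)[OF t(1) s(1) R]
    by (cases "s \<le> t") (auto simp: mult.commute abs_if)
  then have "\<bar>t - s\<bar> / (1 - s * t * R) \<le> 1" using pos by simp
  then show "cmod (moeb u v) \<le> cmod (moeb a b)"
    unfolding eq by (intro mult_left_le_one_le) (use pos in auto)
  assume max: "cmod (moeb u v) = cmod (moeb a b)" and "a \<noteq> b"
  then have "cmod (moeb a b) \<noteq> 0" using a b by (simp add: moeb_eq_0_iff)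
  moreover have "\<bar>t - s\<bar> / (1 - s * t * R) * cmod (moeb a b) = 1 * cmod (moeb a b)"
    using max eq by simp
  ultimately have "\<bar>t - s\<bar> / (1 - s * t * R) = 1" using mult_right_cancel by blast
  then have max': "\<bar>t - s\<bar> = 1 - s * t * R" using pos by simp
  show "(u = a \<and> v = b) \<or> (u = b \<and> v = a)"
  proof (cases "s \<le> t")
    case True
    then have "s = 0 \<and> t = 1"
      using hsegment_diameter_aux(2)[OF s(1) t(1) R] max' by simp
    then show ?thesis using a b by (simp add: s t hpoint_0 hpoint_1)
  next
    case False
    then have "t = 0 \<and> s = 1"
      using hsegment_diameter_aux(2)[OF t(1) s(1) R] max' by (simp add: mult.commute)
    then show ?thesis using a b by (simp add: s t hpoint_0 hpoint_1)
  qed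
qed

text \<open>Automorphisms preserve \<open>cmod (moeb a b)\<close>. Hence the preimages of
  \<open>c\<close> and \<open>d\<close> are two points of the first segment at maximal distance,
  which are its ends. An equality of image sets does not fix the direction, so both orders
  remain.\<close>

lemma disk_aut_hsegment_endpoints:
  assumes g: "g \<in> carrier disk_aut" and ab: "a \<in> disk" "b \<in> disk" "a \<noteq> b"
    and cd: "c \<in> disk" "d \<in> disk" and im: "g ` hsegment a b = hsegment c d"
  shows "(g a = c \<and> g b = d) \<or> (g a = d \<and> g b = c)"
proof -
  have "g a \<in> hsegment c d" "g b \<in> hsegment c d"
    using im endpoints_in_hsegment[OF ab(1,2)] by blast+
  then have le: "cmod (moeb a b) \<le> cmod (moeb c d)"
    using hsegment_diameter(1)[OF cd] cmod_moeb_disk_aut[OF g ab(1,2)] by metis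
  obtain u v where u: "u \<in> hsegment a b" "c = g u" and v: "v \<in> hsegment a b" "d = g v"
    using im endpoints_in_hsegment[OF cd] by blast
  have "u \<in> disk" "v \<in> disk" using u v hsegment_subset_disk[OF ab(1,2)] by blast+
  then have "cmod (moeb c d) = cmod (moeb u v)" using cmod_moeb_disk_aut[OF g] u v by metis
  then have "(u = a \<and> v = b) \<or> (u = b \<and> v = a)"
    using le hsegment_diameter[OF ab(1,2) u(1) v(1)] ab(3) by linarith
  then show ?thesis using u v by auto
qed

text \<open>Equidistance from the ends becomes a quadratic equation for the parameter with exactly
  one root in the unit interval. This is what makes the definite description in
  \<open>hmidpoint\<close> meaningful.\<close>

lemma hmidpoint_hpoint:
  assumes a: "a \<in> disk" and b: "b \<in> disk" and "a \<noteq> b"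
  obtains t where "t \<in> {0..1}" "hmidpoint a b = hpoint a b t"
    "t * (1 - t * (cmod (moeb a b))\<^sup>2) = 1 - t"
proof -
  define R where "R = (cmod (moeb a b))\<^sup>2"
  have R: "0 \<le> R" "R < 1"
    using cmod_moeb_less_1[OF a b] by (simp_all add: R_def abs_square_less_1)
  have r: "cmod (moeb a b) \<noteq> 0" using assms by (simp add: moeb_eq_0_iff)
  have iff: "hdist a (hpoint a b t) = hdist (hpoint a b t) b \<longleftrightarrow> t * (1 - t * R) = 1 - t"
    if t: "t \<in> {0..1}" for t
  proof -
    have pos: "0 < 1 - t * R"
      using hpoint_denominator_pos[OF a b t, of 1] by (simp add: R_def)
    have "cmod (moeb a (hpoint a b t)) = t * cmod (moeb a b)"
      using cmod_moeb_hpoints[OF a b _ t, of 0] a t by (simp add: hpoint_0)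
    moreover have "cmod (moeb (hpoint a b t) b) = (1 - t) / (1 - t * R) * cmod (moeb a b)"
      using cmod_moeb_hpoints[OF a b t, of 1] a b t by (simp add: hpoint_1 R_def)
    moreover have "t * cmod (moeb a b) = (1 - t) / (1 - t * R) * cmod (moeb a b) \<longleftrightarrow> t * (1 - t * R) = 1 - t"
      using pos r by (simp add: nonzero_eq_divide_eq)
    ultimately show ?thesis
      using hdist_eq_iff[OF a hpoint_in_disk[OF a b t] hpoint_in_disk[OF a b t] b] by simp
  qed
  \<comment> \<open>The equation is \<open>R * t^2 - 2 * t + 1 = 0\<close>, with roots
    \<open>(1 - w) / R\<close> and \<open>(1 + w) / R\<close>. The smaller one equals
    \<open>1 / (1 + w)\<close>.\<close>
  define w where "w = sqrt (1 - R)"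
  have w: "0 < w" "R = 1 - w\<^sup>2" using R by (simp_all add: w_def)
  define t where "t = 1 / (1 + w)"
  have t: "t \<in> {0..1}" using w by (simp add: t_def)
  have sol: "t * (1 - t * R) = 1 - t"
  proof -
    have "1 - t * R = w"
      using w(1) unfolding t_def w(2) by (simp add: field_simps power2_eq_square)
    moreover have "1 - t = t * w" using w(1) by (simp add: t_def field_simps)
    ultimately show ?thesis by simp
  qed
  have unique: "s = t" if s: "s \<in> {0..1}" "s * (1 - s * R) = 1 - s" for s
  proof (rule ccontr)
    assume "s \<noteq> t"
    \<comment> \<open>Subtracting the equations for \<open>s\<close> and \<open>t\<close> leaves
      this product; the second factor is positive because \<open>s + t\<close> is at most 2 and
      \<open>R < 1\<close>.\<close>
    have "(t - s) * (2 - (s + t) * R) = 0"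
      using sol s(2) by (simp add: algebra_simps)
    with \<open>s \<noteq> t\<close> have "(s + t) * R = 2" by simp
    moreover have "(s + t) * R \<le> 2 * R" using s(1) t R by (intro mult_right_mono) auto
    ultimately show False using R(2) by simp
  qed
  have "hmidpoint a b = hpoint a b t"
    unfolding hmidpoint_def
  proof (rule the_equality)
    show "hpoint a b t \<in> hsegment a b \<and> hdist a (hpoint a b t) = hdist (hpoint a b t) b"
      using iff[OF t] t sol by (simp add: hsegment_eq)
  next
    fix m assume "m \<in> hsegment a b \<and> hdist a m = hdist m b"
    then show "m = hpoint a b t" using iff unique unfolding hsegment_eq by blast
  qed
  then show ?thesis using that t sol by (simp add: R_def)
qed

lemma hmidpoint_in_disk:
  assumes "a \<in> disk" "b \<in> disk" "a \<noteq> b"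
  shows "hmidpoint a b \<in> disk"
proof -
  obtain t where "t \<in> {0..1}" "hmidpoint a b = hpoint a b t"
    using hmidpoint_hpoint[OF assms] .
  then show ?thesis using hpoint_in_disk[OF assms(1,2)] by simp
qed

text \<open>The ends have parameters 0 and 1, and the midpoint equation turns their coefficients in
  \<open>moeb_hpoints\<close> into \<open>- t\<close> and \<open>t\<close> with the same \<tau>.
  Thus the half-turn, multiplication by -1 in this coordinate, exchanges the ends.\<close>

lemma moeb_hmidpoint:
  assumes a: "a \<in> disk" and b: "b \<in> disk" and ab: "a \<noteq> b"
  shows "moeb (hmidpoint a b) b = - moeb (hmidpoint a b) a"
proof -
  obtain t where t: "t \<in> {0..1}" "hmidpoint a b = hpoint a b t"
    and sol: "t * (1 - t * (cmod (moeb a b))\<^sup>2) = 1 - t"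
    using hmidpoint_hpoint[OF assms] .
  have pos: "0 < 1 - t * (cmod (moeb a b))\<^sup>2"
    using hpoint_denominator_pos[OF a b t(1), of 1] by simp
  obtain \<tau> where \<tau>: "\<And>s. s \<in> {0..1} \<Longrightarrow> moeb (hpoint a b t) (hpoint a b s) =
       \<tau> * (of_real ((s - t) / (1 - t * s * (cmod (moeb a b))\<^sup>2)) * moeb a b)"
    using moeb_hpoints[OF a b t(1)] by metis
  have "(1 - t) / (1 - t * (cmod (moeb a b))\<^sup>2) = t"
    using pos sol by (simp add: nonzero_divide_eq_eq)
  then have "moeb (hmidpoint a b) b = \<tau> * (of_real t * moeb a b)"
    using \<tau>[of 1] a b by (simp add: t(2) hpoint_1)
  moreover have "moeb (hmidpoint a b) a = \<tau> * (of_real (- t) * moeb a b)"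
    using \<tau>[of 0] a by (simp add: t(2) hpoint_0)
  ultimately show ?thesis by simp
qed

section \<open>Half-turns as the automorphisms exchanging two points\<close>

lemma half_turn_disk_aut:
  "a \<in> disk \<Longrightarrow> b \<in> disk \<Longrightarrow> a \<noteq> b \<Longrightarrow> half_turn a b \<in> carrier disk_aut"
  unfolding half_turn_def by (intro rotation_disk_aut hmidpoint_in_disk)

lemma half_turn_swap:
  assumes a: "a \<in> disk" and b: "b \<in> disk" and ab: "a \<noteq> b"
  shows "half_turn a b a = b" "half_turn a b b = a"
proof -
  note m = hmidpoint_in_disk[OF assms]
  have "moeb (hmidpoint a b) (half_turn a b a) = moeb (hmidpoint a b) b"
    unfolding half_turn_def moeb_rotation[OF m a] using moeb_hmidpoint[OF assms] by simp
  then show "half_turn a b a = b"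
    by (intro moeb_inj[OF m disk_aut_in_disk[OF half_turn_disk_aut[OF assms] a] b])
  have "moeb (hmidpoint a b) (half_turn a b b) = moeb (hmidpoint a b) a"
    unfolding half_turn_def moeb_rotation[OF m b] using moeb_hmidpoint[OF assms] by simp
  then show "half_turn a b b = a"
    by (intro moeb_inj[OF m disk_aut_in_disk[OF half_turn_disk_aut[OF assms] b] a])
qed

text \<open>Two points determine an automorphism. Any element reversing an edge is thereby an
  involution fixing the midpoint of that edge.\<close>

lemma half_turn_unique:
  assumes "g \<in> carrier disk_aut" "a \<in> disk" "b \<in> disk" "a \<noteq> b" "g a = b" "g b = a"
  shows "g = half_turn a b"
  using half_turn_swap[OF assms(2-4)] assms(5,6)
  by (intro disk_aut_eq_two_points[OF assms(1) half_turn_disk_aut[OF assms(2-4)] assms(2-4)]) simp_all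

lemma half_turn_commute:
  assumes "a \<in> disk" "b \<in> disk" "a \<noteq> b"
  shows "half_turn b a = half_turn a b"
  using assms(3) by (intro half_turn_unique assms half_turn_disk_aut half_turn_swap) auto

lemma half_turn_involution:
  assumes "a \<in> disk" "b \<in> disk" "a \<noteq> b"
  shows "half_turn a b \<otimes>\<^bsub>disk_aut\<^esub> half_turn a b = \<one>\<^bsub>disk_aut\<^esub>"
proof (rule disk_aut_eq_two_points[OF _ _ assms])
  show "half_turn a b \<otimes>\<^bsub>disk_aut\<^esub> half_turn a b \<in> carrier disk_aut"
    using half_turn_disk_aut[OF assms] by simp
qed (use assms half_turn_disk_aut[OF assms] in
      \<open>simp_all add: disk_aut_mult_apply disk_aut_one_apply half_turn_swap del: mem_ball_0 mem_ball\<close>)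

lemma half_turn_fixes_hmidpoint:
  "a \<in> disk \<Longrightarrow> b \<in> disk \<Longrightarrow> a \<noteq> b \<Longrightarrow> half_turn a b (hmidpoint a b) = hmidpoint a b"
  unfolding half_turn_def by (intro rotation_fixes hmidpoint_in_disk)

section \<open>Triangles and the group of a tiling\<close>

text \<open>The argument of each factor is the oriented angle at one vertex, and the moduli cancel
  because \<open>cmod (moeb a b)\<close> is symmetric. For a triangle the product is therefore
  \<open>cis\<close> of the angle sum.\<close>

definition angle_product :: "complex \<Rightarrow> complex \<Rightarrow> complex \<Rightarrow> complex" where
  "angle_product a b c =
     (moeb a c / moeb a b) * (moeb b a / moeb b c) * (moeb c b / moeb c a)"

text \<open>Only the angle sum modulo 2 pi is kept. This is enough to express vertex rotations by
  half-turns, and it survives cyclic relabelling and automorphisms, as the induction over tiles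
  requires.\<close>

definition angle_triangle :: "real \<Rightarrow> complex \<Rightarrow> complex \<Rightarrow> complex \<Rightarrow> bool" where
  "angle_triangle \<theta> a b c \<longleftrightarrow> a \<in> disk \<and> b \<in> disk \<and> c \<in> disk \<and>
     a \<noteq> b \<and> b \<noteq> c \<and> c \<noteq> a \<and> angle_product a b c = cis \<theta>"

lemma angle_triangle_rotate: "angle_triangle \<theta> a b c \<Longrightarrow> angle_triangle \<theta> b c a"
  by (auto simp: angle_triangle_def angle_product_def mult.commute mult.left_commute)

lemma angle_triangle_disk_aut:
  assumes g: "g \<in> carrier disk_aut" and t: "angle_triangle \<theta> a b c"
  shows "angle_triangle \<theta> (g a) (g b) (g c)"
proof -
  have in_disk: "a \<in> disk" "b \<in> disk" "c \<in> disk" and ne: "a \<noteq> b" "b \<noteq> c" "c \<noteq> a"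
    using t by (auto simp: angle_triangle_def)
  have quot: "moeb (g u) (g v) / moeb (g u) (g w) = moeb u v / moeb u w"
    if uvw: "u \<in> disk" "v \<in> disk" "w \<in> disk" for u v w
  proof -
    obtain \<tau> where "cmod \<tau> = 1" and \<tau>: "\<And>b. b \<in> disk \<Longrightarrow> moeb (g u) (g b) = \<tau> * moeb u b"
      using disk_aut_moeb[OF g uvw(1)] by metis
    then have "\<tau> \<noteq> 0" by auto
    then show ?thesis by (simp add: \<tau>[OF uvw(2)] \<tau>[OF uvw(3)])
  qed
  have "angle_product (g a) (g b) (g c) = angle_product a b c"
    unfolding angle_product_def using quot in_disk by simp
  moreover have "g a \<noteq> g b" "g b \<noteq> g c" "g c \<noteq> g a"
    using disk_aut_inj[OF g] in_disk ne by blast+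
  ultimately show ?thesis
    using t disk_aut_in_disk[OF g] by (simp add: angle_triangle_def del: mem_ball_0 mem_ball)
qed

text \<open>Coinciding vertices make some quotient in \<open>oangle\<close> a division by zero,
  hence 0, and \<open>Arg 0 = 0\<close> is not a positive angle.\<close>

lemma ccw_triangle_distinct:
  assumes "ccw_triangle a b c \<alpha> \<beta> \<gamma>"
  shows "a \<noteq> b" "b \<noteq> c" "c \<noteq> a"
  using assms by (auto simp: ccw_triangle_def oangle_def Moebius_function_eq_zero Arg_zero)

lemma ccw_triangle_angle_triangle:
  assumes t: "ccw_triangle a b c \<alpha> \<beta> \<gamma>"
  shows "angle_triangle (\<alpha> + \<beta> + \<gamma>) a b c"
proof -
  have in_disk: "a \<in> disk" "b \<in> disk" "c \<in> disk" using t by (simp_all add: ccw_triangle_def)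
  note ne = ccw_triangle_distinct[OF t]
  have nz: "moeb a b \<noteq> 0" "moeb b c \<noteq> 0" "moeb c a \<noteq> 0" "moeb b a \<noteq> 0" "moeb c b \<noteq> 0" "moeb a c \<noteq> 0"
    using ne in_disk by (auto simp: moeb_eq_0_iff simp del: mem_ball_0 mem_ball)
  have "cmod (angle_product a b c) = 1"
    using nz by (simp add: angle_product_def norm_mult norm_divide cmod_moeb_commute[of b a]
        cmod_moeb_commute[of c b] cmod_moeb_commute[of a c])
  have polar: "w = of_real (cmod w) * cis (Arg w)" for w
    using rcis_cmod_Arg[of w] by (simp add: rcis_def)
  have "moeb a c / moeb a b = of_real (cmod (moeb a c / moeb a b)) * cis \<alpha>"
    "moeb b a / moeb b c = of_real (cmod (moeb b a / moeb b c)) * cis \<beta>"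
    "moeb c b / moeb c a = of_real (cmod (moeb c b / moeb c a)) * cis \<gamma>"
    using t polar[of "moeb a c / moeb a b"] polar[of "moeb b a / moeb b c"] polar[of "moeb c b / moeb c a"]
    unfolding ccw_triangle_def oangle_def by blast+
  then have "angle_product a b c = (of_real (cmod (moeb a c / moeb a b)) * cis \<alpha>) *
      (of_real (cmod (moeb b a / moeb b c)) * cis \<beta>) * (of_real (cmod (moeb c b / moeb c a)) * cis \<gamma>)"
    unfolding angle_product_def by metis
  also have "\<dots> = of_real (cmod (angle_product a b c)) * (cis \<alpha> * cis \<beta> * cis \<gamma>)"
    unfolding angle_product_def norm_mult of_real_mult by (simp only: mult_ac)
  finally have "angle_product a b c = of_real (cmod (angle_product a b c)) * (cis \<alpha> * cis \<beta> * cis \<gamma>)" .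
  then show ?thesis
    using in_disk ne \<open>cmod (angle_product a b c) = 1\<close> by (simp add: angle_triangle_def cis_mult)
qed

text \<open>A rotation by the angle sum of a triangle is the product of the half-turns about its three
  sides: transporting a direction once around the triangle turns it by the three angles.\<close>

lemma rotation_eq_half_turns:
  assumes t: "angle_triangle \<theta> a b c"
  shows "rotation a \<theta> =
     half_turn c a \<otimes>\<^bsub>disk_aut\<^esub> half_turn b c \<otimes>\<^bsub>disk_aut\<^esub> half_turn a b"
proof (rule disk_aut_eqI)
  have in_disk: "a \<in> disk" "b \<in> disk" "c \<in> disk" and ne: "a \<noteq> b" "b \<noteq> c" "c \<noteq> a"
    and prod: "angle_product a b c = cis \<theta>"
    using t by (auto simp: angle_triangle_def)
  have ht: "half_turn a b \<in> carrier disk_aut" "half_turn b c \<in> carrier disk_aut" "half_turn c a \<in> carrier disk_aut"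
    using half_turn_disk_aut in_disk ne by blast+
  then show "half_turn c a \<otimes>\<^bsub>disk_aut\<^esub> half_turn b c \<otimes>\<^bsub>disk_aut\<^esub> half_turn a b \<in> carrier disk_aut"
    by simp
  show "rotation a \<theta> \<in> carrier disk_aut" using rotation_disk_aut in_disk by blast
  \<comment> \<open>The half-turn sends \<open>u\<close> to \<open>v\<close>, so it multiplies
    vectors by a constant; evaluating at \<open>w = v\<close>, which goes to \<open>u\<close>,
    determines that constant.\<close>
  have step: "moeb v (half_turn u v w) = moeb v u / moeb u v * moeb u w"
    if uv: "u \<in> disk" "v \<in> disk" "u \<noteq> v" and w: "w \<in> disk" for u v w
  proof -
    obtain \<tau> where \<tau>: "\<And>b. b \<in> disk \<Longrightarrow> moeb (half_turn u v u) (half_turn u v b) = \<tau> * moeb u b"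
      using disk_aut_moeb[OF half_turn_disk_aut[OF uv] uv(1)] by metis
    have "moeb u v \<noteq> 0" using moeb_eq_0_iff[OF uv(1,2)] uv(3) by simp
    moreover have "moeb v u = \<tau> * moeb u v"
      using \<tau>[OF uv(2)] half_turn_swap[OF uv] by simp
    ultimately show ?thesis using \<tau>[OF w] half_turn_swap[OF uv] by simp
  qed
  fix z assume z: "z \<in> disk"
  have z1: "half_turn a b z \<in> disk" by (rule disk_aut_in_disk[OF ht(1) z])
  have z2: "half_turn b c (half_turn a b z) \<in> disk" by (rule disk_aut_in_disk[OF ht(2) z1])
  \<comment> \<open>The three constants come grouped by the sides of the triangle; regrouped by its
    vertices they form \<open>angle_product a b c\<close>.\<close>
  have "moeb a (half_turn c a (half_turn b c (half_turn a b z))) = angle_product a b c * moeb a z"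
    unfolding step[OF in_disk(3,1) ne(3) z2] step[OF in_disk(2,3) ne(2) z1] step[OF in_disk(1,2) ne(1) z]
    by (simp add: angle_product_def mult_ac)
  then have "moeb a (rotation a \<theta> z) = moeb a (half_turn c a (half_turn b c (half_turn a b z)))"
    by (simp only: moeb_rotation[OF in_disk(1) z] prod)
  then have "rotation a \<theta> z = half_turn c a (half_turn b c (half_turn a b z))"
    by (rule moeb_inj[OF in_disk(1) rotation_in_disk[OF in_disk(1) z] disk_aut_in_disk[OF ht(3) z2]])
  then show "rotation a \<theta> z =
      (half_turn c a \<otimes>\<^bsub>disk_aut\<^esub> half_turn b c \<otimes>\<^bsub>disk_aut\<^esub> half_turn a b) z"
    using ht z z1 by (simp add: disk_aut_mult_apply disk_aut.m_closed del: mem_ball_0 mem_ball)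
qed

text \<open>Written as a product of half-turns, the rotation about \<open>b\<close> moves the point
  through \<open>a\<close> and \<open>c\<close> to \<open>half_turn a b c\<close>. As it fixes
  \<open>b\<close>, it folds one hexagon edge at \<open>b\<close> onto the other.\<close>

lemma rotation_hexagon_vertex:
  assumes t: "angle_triangle \<theta> a b c"
  shows "rotation b \<theta> (half_turn b c a) = half_turn a b c"
proof -
  have in_disk: "a \<in> disk" "b \<in> disk" "c \<in> disk" and ne: "a \<noteq> b" "b \<noteq> c" "c \<noteq> a"
    using t by (auto simp: angle_triangle_def)
  have ht: "half_turn a b \<in> carrier disk_aut" "half_turn b c \<in> carrier disk_aut" "half_turn c a \<in> carrier disk_aut"
    using half_turn_disk_aut in_disk ne by blast+
  have inv: "half_turn b c (half_turn b c a) = a"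
    using disk_aut_mult_apply[OF ht(2,2) in_disk(1)] half_turn_involution[OF in_disk(2,3) ne(2)]
      disk_aut_one_apply[OF in_disk(1)] by simp
  show ?thesis
    unfolding rotation_eq_half_turns[OF angle_triangle_rotate[OF t]]
    using ht in_disk ne disk_aut_in_disk[OF ht(2) in_disk(1)] inv half_turn_swap(2)[OF in_disk(3,1) ne(3)]
    by (simp add: disk_aut_mult_apply disk_aut.m_closed del: mem_ball_0 mem_ball)
qed

lemma rotation_half_turn_conjugate:
  assumes "a \<in> disk" "b \<in> disk" "c \<in> disk" "c \<noteq> a"
  shows "rotation (half_turn c a b) \<theta> =
    half_turn c a \<otimes>\<^bsub>disk_aut\<^esub> rotation b \<theta> \<otimes>\<^bsub>disk_aut\<^esub> half_turn c a"
proof -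
  define h where "h = half_turn c a"
  have h: "h \<in> carrier disk_aut" unfolding h_def by (rule half_turn_disk_aut[OF assms(3,1,4)])
  have hh: "h (h z) = z" if "z \<in> disk" for z
    using disk_aut_mult_apply[OF h h that] half_turn_involution[OF assms(3,1,4)]
      disk_aut_one_apply[OF that] by (simp add: h_def)
  have hb: "h b \<in> disk" by (rule disk_aut_in_disk[OF h assms(2)])
  have rb: "rotation b \<theta> \<in> carrier disk_aut" by (rule rotation_disk_aut[OF assms(2)])
  have "rotation (h b) \<theta> = h \<otimes>\<^bsub>disk_aut\<^esub> rotation b \<theta> \<otimes>\<^bsub>disk_aut\<^esub> h"
  proof (rule disk_aut_eqI)
    fix z assume z: "z \<in> disk"
    have hz: "h z \<in> disk" by (rule disk_aut_in_disk[OF h z])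
    show "rotation (h b) \<theta> z = (h \<otimes>\<^bsub>disk_aut\<^esub> rotation b \<theta> \<otimes>\<^bsub>disk_aut\<^esub> h) z"
      using rotation_conjugate[OF h assms(2) hz, of \<theta>] h rb z hz hh[OF z]
      by (simp add: disk_aut_mult_apply disk_aut.m_closed del: mem_ball_0 mem_ball)
  qed (use h rb rotation_disk_aut[OF hb] in simp_all)
  then show ?thesis by (simp add: h_def)
qed

text \<open>With \<open>h1, h2, h3\<close> the half-turns about \<open>ab, bc, ca\<close>, the
  product of the three rotations cancels to the word \<open>h3 h2 h3 h1 h3\<close>, and the rotation
  about \<open>h3 b\<close> is the reversed word \<open>h3 h1 h3 h2 h3\<close>.\<close>

lemma rotation_prod:
  assumes t: "angle_triangle \<theta> a b c"
  shows "rotation (half_turn c a b) \<theta> =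
    inv\<^bsub>disk_aut\<^esub> (rotation a \<theta> \<otimes>\<^bsub>disk_aut\<^esub> rotation b \<theta> \<otimes>\<^bsub>disk_aut\<^esub> rotation c \<theta>)"
proof -
  have in_disk: "a \<in> disk" "b \<in> disk" "c \<in> disk" and ne: "a \<noteq> b" "b \<noteq> c" "c \<noteq> a"
    using t by (auto simp: angle_triangle_def)
  define h1 h2 h3 where "h1 = half_turn a b" and "h2 = half_turn b c" and "h3 = half_turn c a"
  have c: "h1 \<in> carrier disk_aut" "h2 \<in> carrier disk_aut" "h3 \<in> carrier disk_aut"
    unfolding h1_def h2_def h3_def using half_turn_disk_aut in_disk ne by blast+
  have i: "h1 \<otimes>\<^bsub>disk_aut\<^esub> h1 = \<one>\<^bsub>disk_aut\<^esub>" "h2 \<otimes>\<^bsub>disk_aut\<^esub> h2 = \<one>\<^bsub>disk_aut\<^esub>"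
    "h3 \<otimes>\<^bsub>disk_aut\<^esub> h3 = \<one>\<^bsub>disk_aut\<^esub>"
    unfolding h1_def h2_def h3_def using half_turn_involution in_disk ne by blast+
  have cancel: "h1 \<otimes>\<^bsub>disk_aut\<^esub> (h1 \<otimes>\<^bsub>disk_aut\<^esub> g) = g" "h2 \<otimes>\<^bsub>disk_aut\<^esub> (h2 \<otimes>\<^bsub>disk_aut\<^esub> g) = g"
    "h3 \<otimes>\<^bsub>disk_aut\<^esub> (h3 \<otimes>\<^bsub>disk_aut\<^esub> g) = g" if "g \<in> carrier disk_aut" for g
    using that c i by (simp_all add: disk_aut.m_assoc[symmetric])
  have eqs: "rotation a \<theta> = h3 \<otimes>\<^bsub>disk_aut\<^esub> h2 \<otimes>\<^bsub>disk_aut\<^esub> h1"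
    "rotation b \<theta> = h1 \<otimes>\<^bsub>disk_aut\<^esub> h3 \<otimes>\<^bsub>disk_aut\<^esub> h2"
    "rotation c \<theta> = h2 \<otimes>\<^bsub>disk_aut\<^esub> h1 \<otimes>\<^bsub>disk_aut\<^esub> h3"
    "rotation (half_turn c a b) \<theta> = h3 \<otimes>\<^bsub>disk_aut\<^esub> rotation b \<theta> \<otimes>\<^bsub>disk_aut\<^esub> h3"
    unfolding h1_def h2_def h3_def
    using rotation_eq_half_turns t angle_triangle_rotate rotation_half_turn_conjugate in_disk ne by blast+
  have "rotation (half_turn c a b) \<theta> \<otimes>\<^bsub>disk_aut\<^esub>
      (rotation a \<theta> \<otimes>\<^bsub>disk_aut\<^esub> rotation b \<theta> \<otimes>\<^bsub>disk_aut\<^esub> rotation c \<theta>) = \<one>\<^bsub>disk_aut\<^esub>"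
    unfolding eqs using c i cancel by (simp add: disk_aut.m_assoc)
  then show ?thesis
    by (intro disk_aut.inv_equality[symmetric] disk_aut.m_closed rotation_disk_aut in_disk
        disk_aut_in_disk[OF half_turn_disk_aut[OF in_disk(3,1) ne(3)]])
qed

text \<open>The middle generator is recovered as
  \<open>inv x \<otimes> (x \<otimes> y \<otimes> z) \<otimes> inv z\<close>. The list on the left
  matches the vertices \<open>a, b, c\<close> after the half-turn about the side
  \<open>ca\<close>.\<close>

lemma (in group) generate_insert_inv_prod:
  assumes "x \<in> carrier G" "y \<in> carrier G" "z \<in> carrier G"
  shows "generate G {z, inv (x \<otimes> y \<otimes> z), x} = generate G {x, y, z}"
proof
  have xyz: "{x, y, z} \<subseteq> carrier G" and sub: "{z, inv (x \<otimes> y \<otimes> z), x} \<subseteq> carrier G"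
    using assms by auto
  note gens = generate.incl[of _ "{x, y, z}" G]
  have "x \<otimes> y \<otimes> z \<in> generate G {x, y, z}" using gens by (auto intro: generate.eng)
  then have "inv (x \<otimes> y \<otimes> z) \<in> generate G {x, y, z}"
    by (rule generate_m_inv_closed[OF xyz])
  with gens show "generate G {z, inv (x \<otimes> y \<otimes> z), x} \<subseteq> generate G {x, y, z}"
    by (intro generate_subgroup_incl generate_is_subgroup xyz) auto
  have "y = inv x \<otimes> inv (inv (x \<otimes> y \<otimes> z)) \<otimes> inv z"
    using assms by (simp add: m_assoc[symmetric]) (simp add: m_assoc)
  also have "\<dots> \<in> generate G {z, inv (x \<otimes> y \<otimes> z), x}"
    by (intro generate.eng generate.inv) auto
  finally show "generate G {x, y, z} \<subseteq> generate G {z, inv (x \<otimes> y \<otimes> z), x}"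
    using generate.incl[of _ "{z, inv (x \<otimes> y \<otimes> z), x}" G]
    by (intro generate_subgroup_incl generate_is_subgroup sub) auto
qed

section \<open>Independence of the vertex group from the chosen tile\<close>

abbreviation vertex_group :: "real \<Rightarrow> complex set \<Rightarrow> (complex \<Rightarrow> complex) set" where
  "vertex_group \<theta> t \<equiv> generate disk_aut ((\<lambda>v. rotation v \<theta>) ` t)"

lemma vertex_group_half_turn:
  assumes t: "angle_triangle \<theta> a b c"
  shows "vertex_group \<theta> (half_turn c a ` {a, b, c}) = vertex_group \<theta> {a, b, c}"
proof -
  have in_disk: "a \<in> disk" "b \<in> disk" "c \<in> disk" and ne: "a \<noteq> b" "b \<noteq> c" "c \<noteq> a"
    using t by (auto simp: angle_triangle_def)
  show ?thesis
    using disk_aut.generate_insert_inv_prod[OF in_disk[THEN rotation_disk_aut], of \<theta> \<theta> \<theta>]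
    by (simp add: half_turn_swap[OF in_disk(3,1) ne(3)] rotation_prod[OF t])
qed

text \<open>Each half-turn to a neighbouring tile replaces one rotation by the inverse of the
  product of all three. A tile is only a set, so the induction also carries a suitably oriented
  labelling of its vertices.\<close>

lemma tiles_from_vertex_group:
  assumes "t \<in> tiles_from {a, b, c}" "angle_triangle \<theta> a b c"
  shows "vertex_group \<theta> t = vertex_group \<theta> {a, b, c}"
proof -
  have "\<exists>u v w. t = {u, v, w} \<and> angle_triangle \<theta> u v w \<and> vertex_group \<theta> t = vertex_group \<theta> {a, b, c}"
    using assms(1)
  proof induction
    case base
    then show ?case using assms(2) by blast
  next
    case (step t d e)
    then obtain u v w where t: "t = {u, v, w}" "angle_triangle \<theta> u v w"
      and eq: "vertex_group \<theta> t = vertex_group \<theta> {a, b, c}" by blast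
    have in_disk: "u \<in> disk" "v \<in> disk" "w \<in> disk" and ne: "u \<noteq> v" "v \<noteq> w" "w \<noteq> u"
      using t(2) by (auto simp: angle_triangle_def)
    \<comment> \<open>Cyclic relabelling makes the chosen side the one from the third vertex to the
      first; the order of \<open>d\<close> and \<open>e\<close> is absorbed by
      \<open>half_turn_commute\<close>.\<close>
    obtain u' v' w' where t': "t = {u', v', w'}" "angle_triangle \<theta> u' v' w'"
      and de: "half_turn d e = half_turn w' u'"
    proof -
      note rotated = t(2) angle_triangle_rotate[OF t(2)] angle_triangle_rotate[OF angle_triangle_rotate[OF t(2)]]
      consider "{d, e} = {w, u}" | "{d, e} = {u, v}" | "{d, e} = {v, w}"
        using step.hyps t(1) by blast
      then show thesis
      proof cases
        case 1
        then have "half_turn d e = half_turn w u"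
          using half_turn_commute in_disk ne by (auto simp: doubleton_eq_iff simp del: mem_ball_0 mem_ball)
        with rotated(1) t(1) show thesis using that by blast
      next
        case 2
        then have "half_turn d e = half_turn u v"
          using half_turn_commute in_disk ne by (auto simp: doubleton_eq_iff simp del: mem_ball_0 mem_ball)
        with rotated(2) t(1) show thesis by (intro that[of v w u]) auto
      next
        case 3
        then have "half_turn d e = half_turn v w"
          using half_turn_commute in_disk ne by (auto simp: doubleton_eq_iff simp del: mem_ball_0 mem_ball)
        with rotated(3) t(1) show thesis by (intro that[of w u v]) auto
      qed
    qed
    have "half_turn w' u' \<in> carrier disk_aut"
      using t'(2) by (intro half_turn_disk_aut) (auto simp: angle_triangle_def)
    then have "angle_triangle \<theta> (half_turn w' u' u') (half_turn w' u' v') (half_turn w' u' w')"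
      by (rule angle_triangle_disk_aut[OF _ t'(2)])
    moreover have "half_turn d e ` t = {half_turn w' u' u', half_turn w' u' v', half_turn w' u' w'}"
      by (simp add: t'(1) de)
    moreover have "vertex_group \<theta> (half_turn d e ` t) = vertex_group \<theta> {a, b, c}"
      using vertex_group_half_turn[OF t'(2)] eq by (simp only: de t'(1))
    ultimately show ?case by blast
  qed
  then show ?thesis by blast
qed

text \<open>\<open>tiling_for\<close> provides one generating tile only; independence of the tile
  transfers this to the tile in hand.\<close>

lemma canonical_tiling_group:
  assumes tiling: "canonical_tiling p G \<alpha> \<beta> \<gamma> \<T>" and t: "t \<in> \<T>"
  shows "G = vertex_group (2 * pi / real p) t"
proof -
  obtain a b c where abc: "ccw_triangle a b c \<alpha> \<beta> \<gamma>" "\<T> = tiles_from {a, b, c}"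
    and sum: "\<alpha> + \<beta> + \<gamma> = 2 * pi / real p"
    using tiling by (auto simp: canonical_tiling_def is_tiling_def)
  obtain s where "s \<in> \<T>" "G = vertex_group (2 * pi / real p) s"
    using tiling by (auto simp: canonical_tiling_def tiling_for_def)
  moreover have "vertex_group (2 * pi / real p) r = vertex_group (2 * pi / real p) {a, b, c}"
    if "r \<in> \<T>" for r
    using tiles_from_vertex_group[of r a b c] that abc(2) ccw_triangle_angle_triangle[OF abc(1)]
    by (simp add: sum)
  ultimately show ?thesis using t by metis
qed

section \<open>Edge identifications\<close>

lemma (in group) nat_pow_mod:
  assumes "x \<in> carrier G" "x [^] p = \<one>"
  shows "x [^] (k mod p :: nat) = x [^] k"
proof -
  have "x [^] k = x [^] (p * (k div p) + k mod p)" by simp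
  also have "\<dots> = (x [^] p) [^] (k div p) \<otimes> x [^] (k mod p)"
    using assms(1) by (simp only: nat_pow_mult nat_pow_pow nat_pow_closed)
  finally show ?thesis using assms by simp
qed

text \<open>The generated subgroup \<open>M\<close> is normalised by \<open>x\<close>, and \<open>M\<langle>x\<rangle>\<close> contains \<open>y = u\<^sup>-\<^sup>1 x\<^sup>i\<close> and
  \<open>z = v\<^sup>-\<^sup>1 x\<^sup>j\<close>. So an element of \<open>N\<close> is some \<open>m x\<^sup>k\<close> with \<open>m \<in> M\<close>, and then \<open>x\<^sup>k \<in> N\<close> forces
  \<open>p dvd k\<close>.\<close>

lemma (in group) subgroup_eq_generate_conjugates:
  fixes p i j :: nat
  assumes p: "prime p" "\<not> p dvd i" "\<not> p dvd j"
    and xyz: "x \<in> carrier G" "y \<in> carrier G" "z \<in> carrier G" and xp: "x [^] p = \<one>"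
    and N: "subgroup N G" "N \<subseteq> generate G {x, y, z}" "x \<notin> N"
    and conj: "\<And>h. h \<in> N \<Longrightarrow> x \<otimes> h \<otimes> inv x \<in> N"
    and uv: "x [^] i \<otimes> inv y \<in> N" "x [^] j \<otimes> inv z \<in> N"
  shows "N = generate G (\<Union>n\<in>{0..p-1}.
     {x [^] (n * i) \<otimes> (x [^] i \<otimes> inv y) \<otimes> inv (x [^] (n * i)),
      x [^] (n * j) \<otimes> (x [^] j \<otimes> inv z) \<otimes> inv (x [^] (n * j))})"
    (is "N = generate G ?S")
proof -
  interpret N: subgroup N G by fact
  define u v where "u = x [^] i \<otimes> inv y" and "v = x [^] j \<otimes> inv z"
  have u: "u \<in> carrier G" "u \<in> N" and v: "v \<in> carrier G" "v \<in> N"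
    using uv xyz by (simp_all add: u_def v_def)
  have pow: "x [^] (k::nat) \<in> carrier G" for k using xyz by simp
  have conj_pow: "x [^] (k::nat) \<otimes> h \<otimes> inv (x [^] k) \<in> N" if "h \<in> N" for h k
  proof (induction k)
    case 0
    then show ?case using that by simp
  next
    case (Suc k)
    have "x [^] Suc k \<otimes> h \<otimes> inv (x [^] Suc k) = x \<otimes> (x [^] k \<otimes> h \<otimes> inv (x [^] k)) \<otimes> inv x"
      using xyz that pow[of k] unfolding nat_pow_Suc2[OF xyz(1)]
      by (simp add: inv_mult_group m_assoc del: nat_pow_Suc)
    then show ?case using conj[OF Suc] by simp
  qed
  have SN: "?S \<subseteq> N" using conj_pow uv by blast
  then have SG: "?S \<subseteq> carrier G" using N.subset by blast
  define M where "M = generate G ?S"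
  have M: "subgroup M G" unfolding M_def by (rule generate_is_subgroup[OF SG])
  interpret M: subgroup M G by (rule M)
  have MN: "M \<subseteq> N" unfolding M_def by (rule generate_subgroup_incl[OF SN N(1)])
  \<comment> \<open>An \<open>l\<close> prime to \<open>p\<close> is invertible modulo
    \<open>p\<close>, so its \<open>p\<close> multiples meet every residue. Hence the exponents
    \<open>n * i\<close> and \<open>n * j\<close> give conjugation by every power of
    \<open>x\<close>.\<close>
  have reduce: "\<exists>n\<in>{0..p-1}. x [^] (n * l) = x [^] (k::nat)" if "\<not> p dvd l" for k l
  proof -
    have "coprime l p" using prime_imp_coprime[OF p(1) that] by (rule coprime_imp_coprime) auto
    then obtain m where "[l * m = 1] (mod p)" using cong_solve_coprime_nat by auto
    then have "[l * m * k = 1 * k] (mod p)" by (rule cong_scalar_right)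
    then have "(m * k mod p * l) mod p = k mod p"
      unfolding mod_mult_left_eq cong_def by (simp add: mult_ac)
    then have "x [^] (m * k mod p * l) = x [^] k"
      using nat_pow_mod[OF xyz(1) xp] by metis
    moreover have "m * k mod p \<in> {0..p-1}"
      using prime_gt_0_nat[OF p(1)] by (simp add: less_Suc_eq_le[symmetric])
    ultimately show ?thesis by blast
  qed
  have gen: "x [^] (k::nat) \<otimes> w \<otimes> inv (x [^] k) \<in> M" if "w \<in> {u, v}" for k w
  proof -
    have "x [^] k \<otimes> w \<otimes> inv (x [^] k) \<in> ?S"
      using reduce[OF p(2), of k] reduce[OF p(3), of k] that unfolding u_def v_def by force
    then show ?thesis unfolding M_def by (rule generate.incl)
  qed
  have x_conj_gen: "x [^] (k::nat) \<otimes> s \<otimes> inv (x [^] k) \<in> M" if s: "s \<in> ?S" for k s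
  proof -
    obtain l w where w: "w \<in> {u, v}" "s = x [^] (l::nat) \<otimes> w \<otimes> inv (x [^] l)"
      using s unfolding u_def v_def by blast
    have "w \<in> carrier G" using w u v by blast
    then have "x [^] k \<otimes> s \<otimes> inv (x [^] k) = x [^] (k + l) \<otimes> w \<otimes> inv (x [^] (k + l))"
      using pow by (simp add: w(2) nat_pow_mult[OF xyz(1), symmetric] inv_mult_group m_assoc)
    then show ?thesis using gen[OF w(1)] by simp
  qed
  have x_conj: "x [^] (k::nat) \<otimes> m \<otimes> inv (x [^] k) \<in> M" if m: "m \<in> M" for k m
    using m unfolding M_def
  proof (induction rule: generate.induct)
    case one
    then show ?case using pow by (simp add: generate.one)
  next
    case (incl h)
    then show ?case using x_conj_gen by (simp add: M_def)
  next
    case (inv h)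
    have "h \<in> carrier G" using inv SG by blast
    then have "x [^] k \<otimes> inv h \<otimes> inv (x [^] k) = inv (x [^] k \<otimes> h \<otimes> inv (x [^] k))"
      using pow by (simp add: inv_mult_group m_assoc)
    then show ?case using M.m_inv_closed[OF x_conj_gen[OF inv]] by (simp add: M_def)
  next
    case (eng g h)
    have "g \<in> carrier G" "h \<in> carrier G"
      using eng.hyps M.subset unfolding M_def by blast+
    then have "x [^] k \<otimes> (g \<otimes> h) \<otimes> inv (x [^] k) =
        (x [^] k \<otimes> g \<otimes> inv (x [^] k)) \<otimes> (x [^] k \<otimes> h \<otimes> inv (x [^] k))"
      using pow[of k] by (simp add: m_assoc) (simp add: m_assoc[symmetric])
    then show ?case using generate.eng[OF eng.IH] by simp
  qed
  define K where "K = {g. \<exists>m\<in>M. \<exists>k::nat. g = m \<otimes> x [^] k}"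
  have KI: "m \<in> M \<Longrightarrow> m \<otimes> x [^] (k::nat) \<in> K" for m k by (auto simp: K_def)
  \<comment> \<open>Exponents are natural numbers, so closure of \<open>K\<close> under inverses
    needs a nonnegative exponent for \<open>inv (x [^] k)\<close>.\<close>
  have inv_pow: "inv (x [^] k) = x [^] ((p - 1) * k)" for k :: nat
  proof -
    have "(p - 1) * k + k = p * k"
      using prime_gt_0_nat[OF p(1)] by (cases p) simp_all
    then have "x [^] ((p - 1) * k) \<otimes> x [^] k = x [^] (p * k)"
      by (simp only: nat_pow_mult[OF xyz(1)])
    also have "\<dots> = \<one>"
      by (simp only: nat_pow_pow[OF xyz(1), symmetric] xp nat_pow_one)
    finally have "x [^] ((p - 1) * k) \<otimes> x [^] k = \<one>" .
    then show ?thesis using pow by (simp add: inv_equality)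
  qed
  have "subgroup K G"
  proof (rule subgroupI)
    show "K \<subseteq> carrier G" using pow M.subset by (auto simp: K_def)
    show "K \<noteq> {}" using KI[OF M.one_closed] by blast
  next
    fix g assume "g \<in> K"
    then obtain m k where m: "m \<in> M" "g = m \<otimes> x [^] (k::nat)" by (auto simp: K_def)
    define l where "l = (p - 1) * k"
    have "inv g = inv (x [^] k) \<otimes> inv m" using m pow by (simp add: inv_mult_group)
    also have "\<dots> = x [^] l \<otimes> inv m" by (simp add: inv_pow l_def)
    also have "\<dots> = (x [^] l \<otimes> inv m \<otimes> inv (x [^] l)) \<otimes> x [^] l"
      using m pow[of l] by (simp add: m_assoc)
    finally show "inv g \<in> K" using KI[OF x_conj[OF M.m_inv_closed[OF m(1)]]] by simp
  next
    fix g h assume "g \<in> K" "h \<in> K"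
    then obtain m k n l where m: "m \<in> M" "g = m \<otimes> x [^] (k::nat)"
      and n: "n \<in> M" "h = n \<otimes> x [^] (l::nat)" by (auto simp: K_def)
    \<comment> \<open>Moving \<open>x [^] k\<close> past \<open>n\<close> costs a conjugation, which
      \<open>M\<close> absorbs by \<open>x_conj\<close>.\<close>
    have "g \<otimes> h = m \<otimes> (x [^] k \<otimes> n \<otimes> inv (x [^] k)) \<otimes> x [^] (k + l)"
      using m n pow[of k] pow[of l] nat_pow_mult[OF xyz(1), of k l, symmetric]
      by (simp add: m_assoc) (simp add: m_assoc[symmetric])
    then show "g \<otimes> h \<in> K" using KI[OF M.m_closed[OF m(1) x_conj[OF n(1)]]] by simp
  qed
  moreover have "x \<in> K" using KI[OF M.one_closed, of 1] xyz by simp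
  moreover have "y \<in> K"
  proof -
    have "u \<in> M" using gen[of u 0] u by simp
    moreover have "y = inv u \<otimes> x [^] i" using xyz by (simp add: u_def inv_mult_group m_assoc)
    ultimately show ?thesis using KI by simp
  qed
  moreover have "z \<in> K"
  proof -
    have "v \<in> M" using gen[of v 0] v by simp
    moreover have "z = inv v \<otimes> x [^] j" using xyz by (simp add: v_def inv_mult_group m_assoc)
    ultimately show ?thesis using KI by simp
  qed
  ultimately have "generate G {x, y, z} \<subseteq> K" by (intro generate_subgroup_incl) auto
  have "N \<subseteq> M"
  proof
    fix g assume g: "g \<in> N"
    then obtain m k where m: "m \<in> M" "g = m \<otimes> x [^] (k::nat)"
      using N(2) \<open>generate G {x, y, z} \<subseteq> K\<close> by (auto simp: K_def)
    have "x [^] k = inv m \<otimes> g" using m pow by (simp add: m_assoc[symmetric])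
    moreover have "inv m \<in> N" using m(1) MN by blast
    ultimately have xk: "x [^] k \<in> N" using g by simp
    have "p dvd k"
    proof (rule ccontr)
      assume "\<not> p dvd k"
      \<comment> \<open>With \<open>k\<close> invertible modulo \<open>p\<close>, the element
        \<open>x\<close> is itself a power of \<open>x [^] k\<close>, which would put it into
        \<open>N\<close>.\<close>
      then obtain n where "x [^] (n * k) = x [^] (1::nat)" using reduce[of k 1] by blast
      moreover have "x [^] (n * k) = (x [^] k) [^] n" using xyz by (simp add: nat_pow_pow mult.commute)
      moreover have "(x [^] k) [^] n \<in> N" using xk by (induction n) auto
      ultimately show False using N(3) xyz by simp
    qed
    then have "x [^] k = \<one>" using xp xyz by (auto simp: nat_pow_pow[symmetric])
    then show "g \<in> M" using m by simp
  qed
  then show ?thesis using MN by (simp add: M_def)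
qed

text \<open>The coset of \<open>s\<close> has a trivial square, and its power to the odd group order
  is trivial too, so the coset itself is trivial.\<close>

lemma (in normal) square_eq_one_mem:
  assumes odd: "odd (order (G Mod H))" and s: "s \<in> carrier G" "s \<otimes> s = \<one>"
  shows "s \<in> H"
proof -
  interpret Q: group "G Mod H" by (rule factorgroup_is_group)
  define c where "c = H #> s"
  have c: "c \<in> carrier (G Mod H)" using s by (auto simp: c_def FactGroup_def RCOSETS_def)
  have cc: "c \<otimes>\<^bsub>G Mod H\<^esub> c = \<one>\<^bsub>G Mod H\<^esub>"
    using s by (simp add: c_def FactGroup_def rcos_sum coset_mult_one subset)
  obtain k where k: "order (G Mod H) = 2 * k + 1" using odd by (rule oddE)
  have sq: "c [^]\<^bsub>G Mod H\<^esub> (2::nat) = \<one>\<^bsub>G Mod H\<^esub>" by (simp only: numeral_2_eq_2 Q.nat_pow_Suc Q.nat_pow_0 Q.l_one[OF c] cc)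
  have "c [^]\<^bsub>G Mod H\<^esub> (2 * k + 1) = c"
    by (simp only: Suc_eq_plus1[symmetric] Q.nat_pow_Suc Q.nat_pow_pow[OF c, symmetric] sq
        Q.nat_pow_one Q.l_one[OF c])
  then have "c = H" using Q.pow_order_eq_1[OF c] k by (simp add: FactGroup_def)
  then show ?thesis unfolding c_def by (rule coset_join1[OF _ s(1) subgroup_axioms])
qed

section \<open>The elements gluing two edges\<close>

lemma acts_freely_fixes:
  assumes "acts_freely G" "g \<in> G" "z \<in> disk" "g z = z"
  shows "g = \<one>\<^bsub>disk_aut\<^esub>"
proof -
  have "g \<in> stab G z" using assms(2,4) by (simp add: stabilizer_def)
  then show ?thesis using assms(1,3) by (simp add: acts_freely_def del: mem_ball_0 mem_ball)
qed

text \<open>An element gluing the two edges either agrees with \<open>g y\<^sup>-\<^sup>1\<close> at both end points or reverses the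
  edge. In the second case it yields an involution, which the odd index puts into \<open>\<Gamma>'\<close> although it
  fixes the midpoint of the edge.\<close>

lemma gluing_hexagon_edges:
  assumes G: "subgroup \<Gamma> disk_aut" and N: "\<Gamma>' \<lhd> subgrp \<Gamma>"
    and odd: "odd (order (subgrp \<Gamma> Mod \<Gamma>'))" and free: "acts_freely \<Gamma>'"
    and t: "angle_triangle \<theta> a b c" and y: "rotation b \<theta> \<in> \<Gamma>" and g: "g \<in> \<Gamma>"
    and glued: "glued \<Gamma>' (hsegment (half_turn a b c) b) (g ` hsegment b (half_turn b c a))"
  shows "gluing \<Gamma>' (hsegment (half_turn a b c) b) (g ` hsegment b (half_turn b c a)) =
      g \<otimes>\<^bsub>disk_aut\<^esub> inv\<^bsub>disk_aut\<^esub> (rotation b \<theta>)" (is ?eq)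
    and "g \<otimes>\<^bsub>disk_aut\<^esub> inv\<^bsub>disk_aut\<^esub> (rotation b \<theta>) \<in> \<Gamma>'" (is ?mem)
proof -
  interpret G: subgroup \<Gamma> disk_aut by fact
  interpret N: normal \<Gamma>' "subgrp \<Gamma>" by fact
  define d e y where "d = half_turn a b c" and "e = half_turn b c a" and "y = rotation b \<theta>"
  have in_disk: "a \<in> disk" "b \<in> disk" "c \<in> disk" and ne: "a \<noteq> b" "b \<noteq> c" "c \<noteq> a"
    using t by (auto simp: angle_triangle_def)
  have d: "d \<in> disk" unfolding d_def
    by (rule disk_aut_in_disk[OF half_turn_disk_aut[OF in_disk(1,2) ne(1)] in_disk(3)])
  have e: "e \<in> disk" unfolding e_def
    by (rule disk_aut_in_disk[OF half_turn_disk_aut[OF in_disk(2,3) ne(2)] in_disk(1)])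
  have db: "d \<noteq> b"
    using disk_aut_inj[OF half_turn_disk_aut[OF in_disk(1,2) ne(1)] in_disk(3,1)] ne(3)
      half_turn_swap(1)[OF in_disk(1,2) ne(1)] unfolding d_def by metis
  have y: "y \<in> \<Gamma>" "y \<in> carrier disk_aut" using assms(6) by (simp_all add: y_def)
  have gc: "g \<in> carrier disk_aut" using g by simp
  have ye: "y e = d" unfolding y_def e_def d_def by (rule rotation_hexagon_vertex[OF t])
  have yb: "y b = b" unfolding y_def by (rule rotation_fixes[OF in_disk(2)])
  have unique: "T = g \<otimes>\<^bsub>disk_aut\<^esub> inv\<^bsub>disk_aut\<^esub> y"
    if T: "T \<in> \<Gamma>'" and im: "T ` hsegment d b = g ` hsegment b e" for T
  proof -
    have TG: "T \<in> \<Gamma>" using T N.subset by auto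
    then have Tc: "T \<in> carrier disk_aut" by simp
    define R where "R = inv\<^bsub>disk_aut\<^esub> g \<otimes>\<^bsub>disk_aut\<^esub> T"
    have R: "R \<in> \<Gamma>" "R \<in> carrier disk_aut" using TG g by (simp_all add: R_def)
    have Rz: "R z = (inv\<^bsub>disk_aut\<^esub> g) (T z)" if "z \<in> disk" for z
      unfolding R_def using that Tc gc by (intro disk_aut_mult_apply) simp_all
    have "R ` hsegment d b = (inv\<^bsub>disk_aut\<^esub> g) ` T ` hsegment d b"
      unfolding image_image using hsegment_subset_disk[OF d in_disk(2)] by (intro image_cong Rz) auto
    also have "\<dots> = (\<lambda>z. z) ` hsegment b e"
      unfolding im image_image
      using hsegment_subset_disk[OF in_disk(2) e] by (intro image_cong disk_aut_inv_apply gc) auto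
    finally have "R ` hsegment d b = hsegment b e" by simp
    then have ends: "(R d = b \<and> R b = e) \<or> (R d = e \<and> R b = b)"
      by (rule disk_aut_hsegment_endpoints[OF R(2) d in_disk(2) db in_disk(2) e])
    \<comment> \<open>Since \<open>y\<close> fixes \<open>b\<close> and sends \<open>e\<close> to
      \<open>d\<close>, it takes the image edge of \<open>R\<close> back to the segment from
      \<open>d\<close> to \<open>b\<close>. So \<open>S\<close> maps this segment to itself, either
      fixing or exchanging its ends.\<close>
    define S where "S = y \<otimes>\<^bsub>disk_aut\<^esub> R"
    have S: "S \<in> \<Gamma>" "S \<in> carrier disk_aut" using y R by (simp_all add: S_def)
    have Sz: "S z = y (R z)" if "z \<in> disk" for z
      unfolding S_def using that y R by (intro disk_aut_mult_apply)
    have "\<not> (R d = b \<and> R b = e)"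
    proof
      assume "R d = b \<and> R b = e"
      then have Sd: "S d = b" "S b = d" using Sz d in_disk ye yb by simp_all
      then have half: "S = half_turn d b" by (rule half_turn_unique[OF S(2) d in_disk(2) db])
      have "S \<otimes>\<^bsub>disk_aut\<^esub> S = \<one>\<^bsub>disk_aut\<^esub>"
        unfolding half by (rule half_turn_involution[OF d in_disk(2) db])
      then have "S \<in> \<Gamma>'" using N.square_eq_one_mem[OF odd] S(1) by simp
      moreover have "S (hmidpoint d b) = hmidpoint d b"
        unfolding half by (rule half_turn_fixes_hmidpoint[OF d in_disk(2) db])
      ultimately have "S = \<one>\<^bsub>disk_aut\<^esub>"
        using acts_freely_fixes[OF free] hmidpoint_in_disk[OF d in_disk(2) db] by blast
      then show False using Sd db d by (simp add: disk_aut_one_apply del: mem_ball_0 mem_ball)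
    qed
    with ends have "S d = d" "S b = b" using Sz d in_disk ye yb by simp_all
    then have "S = \<one>\<^bsub>disk_aut\<^esub>"
      using disk_aut_one_apply d in_disk(2)
      by (intro disk_aut_eq_two_points[OF S(2) disk_aut.one_closed d in_disk(2) db]) simp_all
    then have "R = inv\<^bsub>disk_aut\<^esub> y"
      unfolding S_def using y R disk_aut.inv_equality disk_aut.inv_comm by metis
    moreover have "T = g \<otimes>\<^bsub>disk_aut\<^esub> R"
      unfolding R_def using Tc gc by (simp add: disk_aut.m_assoc[symmetric])
    ultimately show ?thesis by simp
  qed
  \<comment> \<open>The gluing hypothesis yields some element of \<open>\<Gamma>'\<close>;
    uniqueness identifies it, which is how membership of the explicit product is obtained.\<close>
  obtain T where T: "T \<in> \<Gamma>'" "T ` hsegment d b = g ` hsegment b e"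
    using glued by (auto simp: glued_def d_def e_def)
  show ?mem using T unique[OF T] by (simp add: y_def)
  have "(THE T. T \<in> \<Gamma>' \<and> T ` hsegment d b = g ` hsegment b e) = g \<otimes>\<^bsub>disk_aut\<^esub> inv\<^bsub>disk_aut\<^esub> y"
  proof (rule the_equality)
    show "g \<otimes>\<^bsub>disk_aut\<^esub> inv\<^bsub>disk_aut\<^esub> y \<in> \<Gamma>' \<and>
        (g \<otimes>\<^bsub>disk_aut\<^esub> inv\<^bsub>disk_aut\<^esub> y) ` hsegment d b = g ` hsegment b e"
      using T unfolding unique[OF T] by blast
  next
    show "T' = g \<otimes>\<^bsub>disk_aut\<^esub> inv\<^bsub>disk_aut\<^esub> y" if "T' \<in> \<Gamma>' \<and> T' ` hsegment d b = g ` hsegment b e" for T'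
      using that unique by blast
  qed
  then show ?eq by (simp add: gluing_def d_def e_def y_def)
qed

theorem proposition5p2:
  fixes p i j :: nat
    and \<Gamma> \<Gamma>' :: "(complex \<Rightarrow> complex) set"
    and \<alpha> \<beta> \<gamma> :: real
    and \<T> :: "complex set set"
    and A B C :: complex
    and x y z T\<^sub>b T\<^sub>c :: "complex \<Rightarrow> complex"
  assumes "prime p" and "odd p"
    and "fuchsian_group \<Gamma>" and "has_signature_genus0 \<Gamma> [p, p, p, p]"
    and "canonical_tiling p \<Gamma> \<alpha> \<beta> \<gamma> \<T>"
    and "\<Gamma>' \<lhd> subgrp \<Gamma>"
    and "(subgrp \<Gamma> Mod \<Gamma>') \<cong> integer_mod_group p"
    and "acts_freely \<Gamma>'"
    and "{A, B, C} \<in> \<T>" and "ccw_triangle A B C \<alpha> \<beta> \<gamma>"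
    and "x = rotation A (2 * pi / real p)"
    and "y = rotation B (2 * pi / real p)"
    and "z = rotation C (2 * pi / real p)"
    and "i \<in> {1..p-1}" and "j \<in> {1..p-1}" and "\<not> p dvd i + j + 1"
    and "glued \<Gamma>' (edge_b p A B C 1) (edge_b p A B C (2 * i + 2))"
    and "glued \<Gamma>' (edge_c p A B C 1) (edge_c p A B C (2 * j + 2))"
    and "T\<^sub>b = gluing \<Gamma>' (edge_b p A B C 1) (edge_b p A B C (2 * i + 2))"
    and "T\<^sub>c = gluing \<Gamma>' (edge_c p A B C 1) (edge_c p A B C (2 * j + 2))"
  shows "T\<^sub>b = x [^]\<^bsub>disk_aut\<^esub> i \<otimes>\<^bsub>disk_aut\<^esub> inv\<^bsub>disk_aut\<^esub> y \<and>
         T\<^sub>c = x [^]\<^bsub>disk_aut\<^esub> j \<otimes>\<^bsub>disk_aut\<^esub> inv\<^bsub>disk_aut\<^esub> z \<and>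
         \<Gamma>' = generate disk_aut
           (\<Union>n\<in>{0..p-1}.
              {x [^]\<^bsub>disk_aut\<^esub> (n * i) \<otimes>\<^bsub>disk_aut\<^esub> T\<^sub>b \<otimes>\<^bsub>disk_aut\<^esub> inv\<^bsub>disk_aut\<^esub> (x [^]\<^bsub>disk_aut\<^esub> (n * i)),
               x [^]\<^bsub>disk_aut\<^esub> (n * j) \<otimes>\<^bsub>disk_aut\<^esub> T\<^sub>c \<otimes>\<^bsub>disk_aut\<^esub> inv\<^bsub>disk_aut\<^esub> (x [^]\<^bsub>disk_aut\<^esub> (n * j))})"
proof -
  define \<theta> where "\<theta> = 2 * pi / real p"
  note rot = assms(11-13)[folded \<theta>_def]
  have G: "subgroup \<Gamma> disk_aut" using assms(3) by (simp add: fuchsian_group_def)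
  interpret G: subgroup \<Gamma> disk_aut by (rule G)
  interpret N: normal \<Gamma>' "subgrp \<Gamma>" by fact
  have t: "angle_triangle \<theta> A B C"
    using ccw_triangle_angle_triangle[OF assms(10)] assms(5)
    by (simp add: canonical_tiling_def is_tiling_def \<theta>_def)
  have in_disk: "A \<in> disk" "B \<in> disk" "C \<in> disk" and ne: "A \<noteq> B" "B \<noteq> C" "C \<noteq> A"
    using t by (auto simp: angle_triangle_def)
  have gen: "\<Gamma> = generate disk_aut {x, y, z}"
    using canonical_tiling_group[OF assms(5,9)] by (simp add: rot \<theta>_def)
  have xyz: "x \<in> \<Gamma>" "y \<in> \<Gamma>" "z \<in> \<Gamma>"
    unfolding gen by (auto intro: generate.incl)
  have xyz_carrier: "x \<in> carrier disk_aut" "y \<in> carrier disk_aut" "z \<in> carrier disk_aut"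
    using xyz by simp_all
  have p: "3 \<le> p" using prime_ge_2_nat[OF assms(1)] assms(2) by (cases "p = 2") auto
  have "card (carrier (subgrp \<Gamma> Mod \<Gamma>')) = card (carrier (integer_mod_group p))"
    by (rule iso_same_card[OF assms(7)])
  then have "order (subgrp \<Gamma> Mod \<Gamma>') = p"
    using p by (simp add: order_def carrier_integer_mod_group)
  then have odd: "odd (order (subgrp \<Gamma> Mod \<Gamma>'))" using assms(2) by simp
  have pow: "x [^]\<^bsub>disk_aut\<^esub> (n::nat) \<in> \<Gamma>" for n
    using xyz(1) by (induction n) (simp_all add: G.m_closed)
  \<comment> \<open>Edges with index 1 carry the zeroth power of \<open>x\<close>, the identity
    restricted to the disk; it fixes a set pointwise only inside the disk.\<close>
  have one: "\<one>\<^bsub>disk_aut\<^esub> ` s = s" if "s \<subseteq> disk" for s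
    using that by (force simp: disk_aut_one)
  have D: "half_turn A B C \<in> disk" "half_turn B C A \<in> disk"
    using disk_aut_in_disk half_turn_disk_aut in_disk ne by blast+
  \<comment> \<open>The index \<open>2 * i + 2\<close> is even and
    \<open>(2 * i + 1) div 2 = i\<close>, so this edge is the image under the \<open>i\<close>-th
    power of \<open>x\<close> of the second edge at \<open>B\<close>.\<close>
  have b: "edge_b p A B C 1 = hsegment (half_turn A B C) B"
    "edge_b p A B C (2 * i + 2) = (x [^]\<^bsub>disk_aut\<^esub> i) ` hsegment B (half_turn B C A)"
    using one[OF hsegment_subset_disk[OF D(1) in_disk(2)]] by (simp_all add: edge_b_def rot \<theta>_def)
  have c: "edge_c p A B C 1 = hsegment (half_turn B C A) C"
    "edge_c p A B C (2 * j + 2) = (x [^]\<^bsub>disk_aut\<^esub> j) ` hsegment C (half_turn C A B)"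
    using one[OF hsegment_subset_disk[OF D(2) in_disk(3)]] by (simp_all add: edge_c_def rot \<theta>_def)
  note glue_b = gluing_hexagon_edges[OF G assms(6) odd assms(8) t xyz(2)[unfolded rot] pow
      assms(17)[unfolded b], folded b rot, folded assms(19)]
  \<comment> \<open>The edges at \<open>C\<close> are those at the middle vertex of the cyclically
    shifted triangle \<open>B, C, A\<close>.\<close>
  note glue_c = gluing_hexagon_edges[OF G assms(6) odd assms(8) angle_triangle_rotate[OF t]
      xyz(3)[unfolded rot] pow assms(18)[unfolded c], folded c rot, folded assms(20)]
  have "cis (real p * \<theta>) = 1" using p by (simp add: \<theta>_def)
  then have xp: "x [^]\<^bsub>disk_aut\<^esub> p = \<one>\<^bsub>disk_aut\<^esub>"
    using in_disk(1) unfolding rot rotation_pow[OF in_disk(1)]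
    by (intro disk_aut_eqI) (simp_all add: rotation_disk_aut rotation_cis_1 disk_aut_one_apply del: mem_ball_0 mem_ball)
  \<comment> \<open>As \<open>x\<close> fixes \<open>A\<close>, freeness would make it the identity;
    but it multiplies the nonzero \<open>moeb A B\<close> by \<open>cis \<theta>\<close>, and
    \<theta> lies strictly between 0 and pi because \<open>p\<close> is at least 3.\<close>
  have "x \<notin> \<Gamma>'"
  proof
    assume "x \<in> \<Gamma>'"
    moreover have "x A = A" unfolding rot by (rule rotation_fixes[OF in_disk(1)])
    ultimately have "x = \<one>\<^bsub>disk_aut\<^esub>" using acts_freely_fixes[OF assms(8)] in_disk(1) by blast
    then have "x B = B" using disk_aut_one_apply[OF in_disk(2)] by simp
    then have "moeb A B = cis \<theta> * moeb A B"
      using moeb_rotation[OF in_disk(1,2), of \<theta>] by (simp add: rot)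
    then have "cis \<theta> = 1" using moeb_eq_0_iff[OF in_disk(1,2)] ne(1) by simp
    then have "sin \<theta> = 0" by (simp add: complex_eq_iff)
    moreover have "sin \<theta> > 0"
      using p by (intro sin_gt_zero) (simp_all add: \<theta>_def field_simps)
    ultimately show False by simp
  qed
  moreover have "\<not> p dvd i" "\<not> p dvd j"
    using assms(14,15) p by (auto dest!: dvd_imp_le)
  \<comment> \<open>Normality refers to inverses in \<open>subgrp \<Gamma>\<close>, which agree with
    those of \<open>disk_aut\<close> on the subgroup.\<close>
  moreover have "x \<otimes>\<^bsub>disk_aut\<^esub> h \<otimes>\<^bsub>disk_aut\<^esub> inv\<^bsub>disk_aut\<^esub> x \<in> \<Gamma>'" if "h \<in> \<Gamma>'" for h
    using N.inv_op_closed2[of x h] that xyz(1) disk_aut.m_inv_consistent[OF G xyz(1)] by simp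
  moreover have "subgroup \<Gamma>' disk_aut"
    using disk_aut.incl_subgroup[OF G] N.subgroup_axioms by blast
  moreover have "\<Gamma>' \<subseteq> generate disk_aut {x, y, z}" using N.subset gen by simp
  ultimately have "\<Gamma>' = generate disk_aut (\<Union>n\<in>{0..p-1}.
     {x [^]\<^bsub>disk_aut\<^esub> (n * i) \<otimes>\<^bsub>disk_aut\<^esub> (x [^]\<^bsub>disk_aut\<^esub> i \<otimes>\<^bsub>disk_aut\<^esub> inv\<^bsub>disk_aut\<^esub> y) \<otimes>\<^bsub>disk_aut\<^esub> inv\<^bsub>disk_aut\<^esub> (x [^]\<^bsub>disk_aut\<^esub> (n * i)),
      x [^]\<^bsub>disk_aut\<^esub> (n * j) \<otimes>\<^bsub>disk_aut\<^esub> (x [^]\<^bsub>disk_aut\<^esub> j \<otimes>\<^bsub>disk_aut\<^esub> inv\<^bsub>disk_aut\<^esub> z) \<otimes>\<^bsub>disk_aut\<^esub> inv\<^bsub>disk_aut\<^esub> (x [^]\<^bsub>disk_aut\<^esub> (n * j))})"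
    by (intro disk_aut.subgroup_eq_generate_conjugates assms(1) xyz_carrier xp glue_b(2) glue_c(2))
  then show ?thesis by (simp only: glue_b(1) glue_c(1))
qed

end
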